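(* Consider the system $$z'(t) = Az(t) + f(t,z(t), z(\gamma (t))) + g(t,\alpha),\qquad t\in\mathbb R,\qquad (\mathrm{E}_\alpha)$$ with the data $A,f,\gamma,g,\{\theta_k\},\{\zeta_k\},\omega,F,\Gamma,\Lambda,N,\lambda$ described in the context. Assume that: (A1) $\sup_{(t,x,y) \in \mathbb R \times \mathbb R^m \times \mathbb R^m } \|f(t,x,y) \|\leq M_f$ for some positive number $M_f$; (A2) there is a positive number $L_1$ such that $\|f(t,x_1,y) - f(t,x_2,y) \| \leq L_1 \|x_1-x_2 \|$ for every $t\in\mathbb R$, $x_1,x_2,y\in\mathbb R^m$; (A3) there is a positive number $L_2$ such that $\|f(t,x,y_1) - f(t,x,y_2) \| \leq L_2 \|y_1-y_2 \|$ for every $t\in\mathbb R$, $x,y_1,y_2\in\mathbb R^m$; (A5) $\displaystyle \frac{N}{\lambda} \left( 2 L_1 + \frac{ L_2 e^{\lambda \omega/2} \left( e^{\lambda \omega}-1\right) }{ 1-e^{-\lambda \omega/2} }\right) <1$. For $\alpha\in\Lambda$ let $\phi_\alpha$ be the unique solution of $(\mathrm{E}_\alpha)$ bounded on $\mathbb R$, and let $\Omega=\{\phi_\alpha:\alpha\in\Lambda\}$. Then the following assertions hold: (i) If a sequence $\beta \in \Lambda$ is homoclinic to a sequence $\alpha \in \Lambda$, then the function $\phi_{\beta}\in \Omega$ is homoclinic to the function $\phi_{\alpha}\in \Omega$. (ii) If a sequence $\beta \in \Lambda$ is heteroclinic to sequences $\alpha^1, \alpha^2 \in \Lambda$, then the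 function $\phi_{\beta}\in \Omega$ is heteroclinic to the functions $\phi_{\alpha^1}, \phi_{\alpha^2}\in \Omega$. (iii) If the set $\Lambda$ is hyperbolic, then the set $\Omega$ is also hyperbolic.
   Context: Setting. $A \in \mathbb R^{m\times m}$ is a matrix all of whose eigenvalues have negative real parts; $f:\mathbb R \times \mathbb R^m \times \mathbb R^m \to \mathbb R^m$ is continuous in all of its arguments. $\{\theta_k\}_{k\in \mathbb Z}$ and $\{\zeta_k\}_{k\in \mathbb Z}$ are fixed sequences of real numbers such that $\theta_k \leq \zeta_k\leq\theta_{k+1}$ and $\theta_{k+1}-\theta_k=\omega$ for all $k\in\mathbb Z$, for some $\omega>0$. $\Gamma$ is a bounded subset of $\mathbb R^m$, $F:\Gamma\to\Gamma$ is a continuous function, and $\Lambda$ is the set of all orbits of $F$ in $\Gamma$, i.e. of all two-sided sequences $\alpha=\{\alpha_k\}_{k\in\mathbb Z}$ in $\Gamma$ with $\alpha_{k+1}=F(\alpha_k)$ for all $k\in\mathbb Z$. For $\theta_k\le t<\theta_{k+1}$, $k\in\mathbb Z$, one sets $\gamma(t)=\zeta_k$ and, for $\alpha\in\Lambda$, $g(t,\alpha)=\alpha_k$. Vectors carry the Euclidean norm and matrices the spectral norm. $N\ge 1$ and $\lambda>0$ are fixed numbers such that $\|e^{At}\|\le Ne^{-\lambda t}$ for all $t\ge 0$. Solutions. For $\alpha\in\Lambda$, a continuous function $\psi:\mathbb R\to\mathbb R^m$ is a solution of $(\mathrm{E}_\alpha)$ if $\psi'(t)$ exists at each $t\in\mathbb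 R$ with the possible exception of the points $\theta_k$, $k\in\mathbb Z$, where the one-sided derivatives exist, and $\psi$ satisfies the equation on each interval $(\theta_k,\theta_{k+1})$, $k\in\mathbb Z$, and also at the points $\theta_k$ with the right derivative in place of the derivative. Bounded solutions. Assumption (A5) implies $N(L_1+L_2)<\lambda$; under (A1)–(A3) and $N(L_1+L_2)<\lambda$, for each $\alpha\in\Lambda$ the system $(\mathrm{E}_\alpha)$ has a unique solution $\phi_\alpha$ that is bounded on $\mathbb R$. Stable and unstable sets, sequences. For $\alpha\in\Lambda$: $W^s(\alpha)=\{\beta\in\Lambda:\|\alpha_k-\beta_k\|\to0 \text{ as } k\to\infty\}$ and $W^u(\alpha)=\{\beta\in\Lambda:\|\alpha_k-\beta_k\|\to0 \text{ as } k\to-\infty\}$. A sequence $\beta\in\Lambda$ is homoclinic to $\alpha\in\Lambda$ if $\alpha\ne\beta$ and $\beta\in W^s(\alpha)\cap W^u(\alpha)$; $\beta\in\Lambda$ is heteroclinic to $\alpha^1,\alpha^2\in\Lambda$ if $\alpha^1\ne\alpha^2$, $\alpha^1\neq\beta$, $\alpha^2\ne\beta$ and $\beta\in W^s(\alpha^1)\cap W^u(\alpha^2)$. $\Lambda$ is hyperbolic if for each $\alpha\in\Lambda$ each of the sets $W^s(\alpha)$ and $W^u(\alpha)$ contains at least one element different from $\alpha$. Stable and unstable sets, functions. For $\phi_\alpha\in\Omega$: $W^s(\phi_\alpha)=\{\phi_\beta\in\Omega:\|\phi_\alpha(t)-\phi_\beta(t)\|\to0\text{ as }t\to\infty\}$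 and $W^u(\phi_\alpha)=\{\phi_\beta\in\Omega:\|\phi_\alpha(t)-\phi_\beta(t)\|\to0\text{ as }t\to-\infty\}$. A function $\phi_\beta\in\Omega$ is homoclinic to $\phi_\alpha\in\Omega$ if $\alpha\ne\beta$ and $\phi_\beta\in W^s(\phi_\alpha)\cap W^u(\phi_\alpha)$; $\phi_\beta\in\Omega$ is heteroclinic to $\phi_{\alpha^1},\phi_{\alpha^2}\in\Omega$ if $\alpha^1\ne\alpha^2$, $\alpha^1\ne\beta$, $\alpha^2\neq\beta$ and $\phi_\beta\in W^s(\phi_{\alpha^1})\cap W^u(\phi_{\alpha^2})$. $\Omega$ is hyperbolic if for every $\alpha\in\Lambda$ each of the sets $W^s(\phi_\alpha)$ and $W^u(\phi_\alpha)$ contains at least one element different from $\phi_\alpha$. *)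

theory Defs
  imports "HOL-Analysis.Analysis"
begin

text \<open>The class-level product (hence also \<open>^\<close> and \<open>exp\<close>) on \<open>real ^ 'm ^ 'm\<close> is componentwise,
  so the exponential series is written with the matrix product \<open>**\<close>.\<close>

definition matrix_exp :: "real ^ 'm ^ 'm \<Rightarrow> real ^ 'm ^ 'm" where
  "matrix_exp A = (\<Sum>n. (((**) A ^^ n) (mat 1)) /\<^sub>R fact n)"

text \<open>The class-level \<open>norm\<close> of a matrix is the Frobenius norm; the spectral norm is the operator
  norm for the Euclidean norm on vectors.\<close>

definition spectral_norm :: "real ^ 'm ^ 'm \<Rightarrow> real" where
  "spectral_norm A = onorm ((*v) A)"

definition complex_eigenvalue :: "real ^ 'm ^ 'm \<Rightarrow> complex \<Rightarrow> bool" where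
  "complex_eigenvalue A c \<longleftrightarrow>
     (\<exists>v :: complex ^ 'm. v \<noteq> 0 \<and> map_matrix complex_of_real A *v v = c *s v)"

text \<open>When \<open>\<theta> (k + 1) - \<theta> k = \<omega> > 0\<close> for all \<open>k\<close>, every \<open>t\<close> lies in exactly one interval
  \<open>[\<theta> k, \<theta> (k + 1))\<close>.\<close>

definition interval_index :: "(int \<Rightarrow> real) \<Rightarrow> real \<Rightarrow> int" where
  "interval_index \<theta> t = (THE k. \<theta> k \<le> t \<and> t < \<theta> (k + 1))"

definition arg_fun :: "(int \<Rightarrow> real) \<Rightarrow> (int \<Rightarrow> real) \<Rightarrow> real \<Rightarrow> real" where
  "arg_fun \<theta> \<zeta> t = \<zeta> (interval_index \<theta> t)"

definition forcing :: "(int \<Rightarrow> real) \<Rightarrow> real \<Rightarrow> (int \<Rightarrow> 'a) \<Rightarrow> 'a" where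
  "forcing \<theta> t \<alpha> = \<alpha> (interval_index \<theta> t)"

definition system_rhs ::
  "real ^ 'm ^ 'm \<Rightarrow> (real \<Rightarrow> real ^ 'm \<Rightarrow> real ^ 'm \<Rightarrow> real ^ 'm) \<Rightarrow>
   (int \<Rightarrow> real) \<Rightarrow> (int \<Rightarrow> real) \<Rightarrow> (int \<Rightarrow> real ^ 'm) \<Rightarrow> (real \<Rightarrow> real ^ 'm) \<Rightarrow> real \<Rightarrow> real ^ 'm" where
  "system_rhs A f \<theta> \<zeta> \<alpha> \<psi> t =
     A *v \<psi> t + f t (\<psi> t) (\<psi> (arg_fun \<theta> \<zeta> t)) + forcing \<theta> t \<alpha>"

definition is_solution ::
  "real ^ 'm ^ 'm \<Rightarrow> (real \<Rightarrow> real ^ 'm \<Rightarrow> real ^ 'm \<Rightarrow> real ^ 'm) \<Rightarrow>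
   (int \<Rightarrow> real) \<Rightarrow> (int \<Rightarrow> real) \<Rightarrow> (int \<Rightarrow> real ^ 'm) \<Rightarrow> (real \<Rightarrow> real ^ 'm) \<Rightarrow> bool" where
  "is_solution A f \<theta> \<zeta> \<alpha> \<psi> \<longleftrightarrow>
     continuous_on UNIV \<psi> \<and>
     (\<forall>t. t \<notin> range \<theta> \<longrightarrow> (\<exists>D. (\<psi> has_vector_derivative D) (at t))) \<and>
     (\<forall>k. (\<exists>D. (\<psi> has_vector_derivative D) (at_left (\<theta> k))) \<and>
          (\<exists>D. (\<psi> has_vector_derivative D) (at_right (\<theta> k)))) \<and>
     (\<forall>k. \<forall>t\<in>{\<theta> k<..<\<theta> (k + 1)}.
          (\<psi> has_vector_derivative system_rhs A f \<theta> \<zeta> \<alpha> \<psi> t) (at t)) \<and>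
     (\<forall>k. (\<psi> has_vector_derivative system_rhs A f \<theta> \<zeta> \<alpha> \<psi> (\<theta> k)) (at_right (\<theta> k)))"

definition bounded_solution ::
  "real ^ 'm ^ 'm \<Rightarrow> (real \<Rightarrow> real ^ 'm \<Rightarrow> real ^ 'm \<Rightarrow> real ^ 'm) \<Rightarrow>
   (int \<Rightarrow> real) \<Rightarrow> (int \<Rightarrow> real) \<Rightarrow> (int \<Rightarrow> real ^ 'm) \<Rightarrow> real \<Rightarrow> real ^ 'm" where
  "bounded_solution A f \<theta> \<zeta> \<alpha> = (THE \<psi>. is_solution A f \<theta> \<zeta> \<alpha> \<psi> \<and> bounded (range \<psi>))"

definition orbits :: "('a \<Rightarrow> 'a) \<Rightarrow> 'a set \<Rightarrow> (int \<Rightarrow> 'a) set" where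
  "orbits F \<Gamma> = {\<alpha>. (\<forall>k. \<alpha> k \<in> \<Gamma>) \<and> (\<forall>k. \<alpha> (k + 1) = F (\<alpha> k))}"

text \<open>Used both for two-sided sequences (\<open>'t = int\<close>) and for functions on the line
  (\<open>'t = real\<close>).\<close>

definition stable_set ::
  "('t::linorder \<Rightarrow> 'a::real_normed_vector) set \<Rightarrow> ('t \<Rightarrow> 'a) \<Rightarrow> ('t \<Rightarrow> 'a) set" where
  "stable_set S x = {y \<in> S. ((\<lambda>t. norm (x t - y t)) \<longlongrightarrow> 0) at_top}"

definition unstable_set ::
  "('t::linorder \<Rightarrow> 'a::real_normed_vector) set \<Rightarrow> ('t \<Rightarrow> 'a) \<Rightarrow> ('t \<Rightarrow> 'a) set" where
  "unstable_set S x = {y \<in> S. ((\<lambda>t. norm (x t - y t)) \<longlongrightarrow> 0) at_bot}"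

definition hyperbolic :: "('t::linorder \<Rightarrow> 'a::real_normed_vector) set \<Rightarrow> bool" where
  "hyperbolic S \<longleftrightarrow>
     (\<forall>x\<in>S. (\<exists>y\<in>stable_set S x. y \<noteq> x) \<and> (\<exists>y\<in>unstable_set S x. y \<noteq> x))"

definition homoclinic ::
  "(int \<Rightarrow> 'a::real_normed_vector) set \<Rightarrow> (int \<Rightarrow> 'a) \<Rightarrow> (int \<Rightarrow> 'a) \<Rightarrow> bool" where
  "homoclinic \<Lambda> \<beta> \<alpha> \<longleftrightarrow>
     \<beta> \<in> \<Lambda> \<and> \<alpha> \<in> \<Lambda> \<and> \<alpha> \<noteq> \<beta> \<and> \<beta> \<in> stable_set \<Lambda> \<alpha> \<inter> unstable_set \<Lambda> \<alpha>"

definition heteroclinic ::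
  "(int \<Rightarrow> 'a::real_normed_vector) set \<Rightarrow> (int \<Rightarrow> 'a) \<Rightarrow> (int \<Rightarrow> 'a) \<Rightarrow> (int \<Rightarrow> 'a) \<Rightarrow> bool" where
  "heteroclinic \<Lambda> \<beta> \<alpha>1 \<alpha>2 \<longleftrightarrow>
     \<beta> \<in> \<Lambda> \<and> \<alpha>1 \<in> \<Lambda> \<and> \<alpha>2 \<in> \<Lambda> \<and> \<alpha>1 \<noteq> \<alpha>2 \<and> \<alpha>1 \<noteq> \<beta> \<and> \<alpha>2 \<noteq> \<beta> \<and>
     \<beta> \<in> stable_set \<Lambda> \<alpha>1 \<inter> unstable_set \<Lambda> \<alpha>2"

text \<open>For the functions \<open>\<phi> \<alpha>\<close> the distinctness conditions refer to the indexing sequences, so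
  these notions take the family \<open>\<phi>\<close> and the indices as arguments.\<close>

definition homoclinic_fun ::
  "(int \<Rightarrow> 'a::real_normed_vector) set \<Rightarrow> ((int \<Rightarrow> 'a) \<Rightarrow> real \<Rightarrow> 'a) \<Rightarrow>
   (int \<Rightarrow> 'a) \<Rightarrow> (int \<Rightarrow> 'a) \<Rightarrow> bool" where
  "homoclinic_fun \<Lambda> \<phi> \<beta> \<alpha> \<longleftrightarrow>
     \<beta> \<in> \<Lambda> \<and> \<alpha> \<in> \<Lambda> \<and> \<alpha> \<noteq> \<beta> \<and>
     \<phi> \<beta> \<in> stable_set (\<phi> ` \<Lambda>) (\<phi> \<alpha>) \<inter> unstable_set (\<phi> ` \<Lambda>) (\<phi> \<alpha>)"

definition heteroclinic_fun ::
  "(int \<Rightarrow> 'a::real_normed_vector) set \<Rightarrow> ((int \<Rightarrow> 'a) \<Rightarrow> real \<Rightarrow> 'a) \<Rightarrow>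
   (int \<Rightarrow> 'a) \<Rightarrow> (int \<Rightarrow> 'a) \<Rightarrow> (int \<Rightarrow> 'a) \<Rightarrow> bool" where
  "heteroclinic_fun \<Lambda> \<phi> \<beta> \<alpha>1 \<alpha>2 \<longleftrightarrow>
     \<beta> \<in> \<Lambda> \<and> \<alpha>1 \<in> \<Lambda> \<and> \<alpha>2 \<in> \<Lambda> \<and> \<alpha>1 \<noteq> \<alpha>2 \<and> \<alpha>1 \<noteq> \<beta> \<and> \<alpha>2 \<noteq> \<beta> \<and>
     \<phi> \<beta> \<in> stable_set (\<phi> ` \<Lambda>) (\<phi> \<alpha>1) \<inter> unstable_set (\<phi> ` \<Lambda>) (\<phi> \<alpha>2)"

end

theory Submission
  imports Defs
begin

text \<open>A function is a bounded solution iff it is a bounded fixed point of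
  \<open>\<psi> \<mapsto> \<integral>_{-\<infinity>}^t e^{A(t-s)} (f(s, \<psi>(s), \<psi>(\<gamma>(s))) + g(s, \<alpha>)) ds\<close>, which is a contraction with factor
  \<open>q = N (L\<^sub>1 + L\<^sub>2) / \<lambda> < 1\<close>; this gives existence and uniqueness of \<open>\<phi>_\<alpha>\<close>. If \<open>w = \<phi>_\<alpha> - \<phi>_\<beta>\<close> satisfies
  \<open>\<parallel>w\<parallel> \<le> c\<close> near \<open>\<plusminus>\<infinity>\<close> and \<open>\<alpha>_k - \<beta>_k \<rightarrow> 0\<close> there, the variation of constants formula improves the
  bound to \<open>q c + \<epsilon>\<close> near \<open>\<plusminus>\<infinity>\<close>, and iterating yields \<open>w \<rightarrow> 0\<close> without any Gronwall inequality.
  Distinct sequences have distinct solutions because the right derivative of a solution at \<open>\<theta>_k\<close>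
  determines \<open>\<alpha>_k\<close>.\<close>

section \<open>The matrix exponential\<close>

abbreviation matpow :: "real ^ 'm ^ 'm \<Rightarrow> nat \<Rightarrow> real ^ 'm ^ 'm" where
  "matpow A n \<equiv> ((**) A ^^ n) (mat 1)"

lemma matpow_scaleR: "matpow (t *\<^sub>R A) n = t ^ n *\<^sub>R matpow A n"
  by (induction n) (simp_all add: vec_eq_iff matrix_matrix_mult_def sum_distrib_left algebra_simps)

lemma matpow_commute: "A ** matpow A n = matpow A n ** A"
proof (induction n)
  case (Suc n)
  then show ?case
    using matrix_mul_assoc[of A "matpow A n" A] by simp
qed simp

text \<open>The sum of all absolute entries dominates every row sum, so each further factor
  \<open>A\<close> costs at most one factor \<open>?K\<close>. The estimate is crude, but it only
  has to feed a comparison with an exponential series.\<close>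

lemma matpow_component_bound:
  "\<bar>matpow A n $ i $ j\<bar> \<le> (\<Sum>k\<in>UNIV. \<Sum>l\<in>UNIV. \<bar>A $ k $ l\<bar>) ^ n"
proof (induction n arbitrary: i j)
  case 0
  show ?case by (simp add: mat_def)
next
  case (Suc n)
  let ?K = "\<Sum>k\<in>UNIV. \<Sum>l\<in>UNIV. \<bar>A $ k $ l\<bar>"
  have "\<bar>matpow A (Suc n) $ i $ j\<bar> \<le> (\<Sum>k\<in>UNIV. \<bar>A $ i $ k * matpow A n $ k $ j\<bar>)"
    by (simp add: matrix_matrix_mult_def sum_abs)
  also have "\<dots> \<le> (\<Sum>k\<in>UNIV. \<bar>A $ i $ k\<bar> * ?K ^ n)"
    by (intro sum_mono) (simp add: abs_mult Suc mult_left_mono)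
  also have "\<dots> = (\<Sum>k\<in>UNIV. \<bar>A $ i $ k\<bar>) * ?K ^ n"
    by (simp add: sum_distrib_right)
  also have "\<dots> \<le> ?K * ?K ^ n"
    by (intro mult_right_mono member_le_sum[where f = "\<lambda>k. \<Sum>l\<in>UNIV. \<bar>A $ k $ l\<bar>"])
       (auto intro!: sum_nonneg zero_le_power)
  finally show ?case by simp
qed

text \<open>The comparison series is that of the real exponential at
  \<open>?K * \<bar>t\<bar>\<close>. The terms are written as coefficient times \<open>t ^ n\<close>
  so that the theory of real power series applies to each entry.\<close>

lemma summable_matpow_component:
  fixes A :: "real ^ 'm ^ 'm" and t :: real
  shows "summable (\<lambda>n. matpow A n $ i $ j / fact n * t ^ n)"
proof (rule summable_comparison_test')
  let ?K = "\<Sum>k\<in>UNIV. \<Sum>l\<in>UNIV. \<bar>A $ k $ l\<bar>"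
  show "summable (\<lambda>n. inverse (fact n) * (?K * \<bar>t\<bar>) ^ n)"
    by (rule summable_exp)
  show "norm (matpow A n $ i $ j / fact n * t ^ n) \<le> inverse (fact n) * (?K * \<bar>t\<bar>) ^ n" for n
    using mult_right_mono[OF matpow_component_bound[where A = A and n = n and i = i and j = j], of "\<bar>t\<bar> ^ n / fact n"]
    by (simp add: abs_mult power_abs power_mult_distrib field_simps)
qed

text \<open>Convergence of matrices is entrywise, so every entry of the exponential is a real power
  series in \<open>t\<close>. Differentiation and commutation are carried out on these
  series.\<close>

lemma matrix_exp_component:
  "matrix_exp (t *\<^sub>R A) $ i $ j = (\<Sum>n. matpow A n $ i $ j / fact n * t ^ n)"
proof -
  have "(\<lambda>n. matpow (t *\<^sub>R A) n /\<^sub>R fact n) sums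
          (\<chi> i j. \<Sum>n. matpow A n $ i $ j / fact n * t ^ n)"
    unfolding sums_def
  proof (intro vec_tendstoI)
    fix i j
    show "(\<lambda>n. (\<Sum>k<n. matpow (t *\<^sub>R A) k /\<^sub>R fact k) $ i $ j) \<longlonglongrightarrow>
            (\<chi> i j. \<Sum>n. matpow A n $ i $ j / fact n * t ^ n) $ i $ j"
      using summable_LIMSEQ[OF summable_matpow_component[of A i j t]]
      by (simp add: matpow_scaleR field_simps)
  qed
  then show ?thesis
    by (simp add: matrix_exp_def sums_iff)
qed

text \<open>Differentiating term by term, \<open>diffs\<close> cancels one factor of the factorial
  and leaves \<open>matpow A (Suc n) / fact n\<close>. The recursion of \<open>matpow\<close> then
  splits off \<open>A\<close> on the left.\<close>

lemma matrix_exp_component_derivative: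
  "((\<lambda>t. matrix_exp (t *\<^sub>R A) $ i $ j) has_real_derivative (A ** matrix_exp (t *\<^sub>R A)) $ i $ j) (at t)"
proof -
  have "(\<Sum>n. diffs (\<lambda>n. matpow A n $ i $ j / fact n) n * t ^ n) =
        (\<Sum>n. \<Sum>k\<in>UNIV. A $ i $ k * (matpow A n $ k $ j / fact n * t ^ n))"
    by (intro suminf_cong)
       (simp add: diffs_def matrix_matrix_mult_def sum_distrib_right sum_distrib_left
         sum_divide_distrib mult.assoc)
  also have "\<dots> = (\<Sum>k\<in>UNIV. A $ i $ k * (\<Sum>n. matpow A n $ k $ j / fact n * t ^ n))"
    by (simp add: suminf_sum suminf_mult summable_mult summable_matpow_component del: times_divide_eq_left)
  also have "\<dots> = (A ** matrix_exp (t *\<^sub>R A)) $ i $ j"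
    by (simp add: matrix_matrix_mult_def matrix_exp_component)
  finally show ?thesis
    using termdiffs_strong_converges_everywhere[OF summable_matpow_component[of A i j], of t]
    by (simp add: matrix_exp_component)
qed

text \<open>Each power commutes with \<open>A\<close>, and the finite sums of the matrix product can
  be exchanged with the series. This moves \<open>A\<close> to the right of the exponential, next to
  the vector, as variation of constants requires.\<close>

lemma matrix_exp_commute: "A ** matrix_exp (t *\<^sub>R A) = matrix_exp (t *\<^sub>R A) ** A"
proof -
  have "(\<Sum>k\<in>UNIV. A $ i $ k * (\<Sum>n. matpow A n $ k $ j / fact n * t ^ n)) =
        (\<Sum>k\<in>UNIV. (\<Sum>n. matpow A n $ i $ k / fact n * t ^ n) * A $ k $ j)" for i j
  proof -
    have "(\<Sum>k\<in>UNIV. A $ i $ k * (\<Sum>n. matpow A n $ k $ j / fact n * t ^ n)) =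
          (\<Sum>n. \<Sum>k\<in>UNIV. A $ i $ k * (matpow A n $ k $ j / fact n * t ^ n))"
      by (simp add: suminf_sum suminf_mult summable_mult summable_matpow_component del: times_divide_eq_left)
    also have "\<dots> = (\<Sum>n. (A ** matpow A n) $ i $ j * (t ^ n / fact n))"
      by (simp add: matrix_matrix_mult_def sum_distrib_left sum_distrib_right sum_divide_distrib mult_ac)
    also have "\<dots> = (\<Sum>n. (matpow A n ** A) $ i $ j * (t ^ n / fact n))"
      by (simp only: matpow_commute)
    also have "\<dots> = (\<Sum>n. \<Sum>k\<in>UNIV. (matpow A n $ i $ k / fact n * t ^ n) * A $ k $ j)"
      by (simp add: matrix_matrix_mult_def sum_distrib_left sum_distrib_right sum_divide_distrib mult_ac)
    also have "\<dots> = (\<Sum>k\<in>UNIV. (\<Sum>n. matpow A n $ i $ k / fact n * t ^ n) * A $ k $ j)"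
      by (simp add: suminf_sum suminf_mult2[symmetric] summable_mult2 summable_matpow_component del: times_divide_eq_left)
    finally show ?thesis .
  qed
  then show ?thesis
    by (simp add: vec_eq_iff matrix_matrix_mult_def matrix_exp_component)
qed

lemma matrix_exp_has_vector_derivative:
  "((\<lambda>t. matrix_exp (t *\<^sub>R A)) has_vector_derivative A ** matrix_exp (t *\<^sub>R A)) (at t)"
proof -
  have "((\<lambda>t. matrix_exp (t *\<^sub>R A) \<bullet> b) has_derivative (\<lambda>x. (x *\<^sub>R (A ** matrix_exp (t *\<^sub>R A))) \<bullet> b)) (at t)"
    if "b \<in> Basis" for b
  proof -
    from that obtain i j where b: "b = axis i (axis j 1)"
      by (auto simp: Basis_vec_def)
    show ?thesis
      using has_derivative_eq_rhs[OF matrix_exp_component_derivative[of A i j t, unfolded has_field_derivative_def]]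
      by (simp add: b inner_axis fun_eq_iff)
  qed
  then show ?thesis
    unfolding has_vector_derivative_def by (subst has_derivative_componentwise_within) blast
qed

lemma matrix_exp_0: "matrix_exp 0 = mat 1"
proof -
  have "matrix_exp 0 $ i $ j = (mat 1 :: real ^ 'a ^ 'a) $ i $ j" for i j
    using matrix_exp_component[of 0 0 i j] powser_zero[of "\<lambda>n. matpow 0 n $ i $ j / fact n"] by simp
  then show ?thesis by (simp add: vec_eq_iff)
qed

lemma bounded_bilinear_matrix_vector_mult:
  "bounded_bilinear ((*v) :: real ^ 'n ^ 'm \<Rightarrow> real ^ 'n \<Rightarrow> real ^ 'm)"
  unfolding bilinear_conv_bounded_bilinear[symmetric] bilinear_def
  by (auto intro!: linearI simp: algebra_simps scaleR_matrix_vector_assoc)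

text \<open>Product rule: differentiating the exponential factor contributes the term with
  \<open>- A *v \<psi> s\<close>. If \<open>D\<close> is \<open>A *v \<psi> s + r s\<close>, only
  the inhomogeneity \<open>r s\<close> survives.\<close>

lemma variation_of_constants_derivative:
  assumes "(\<psi> has_vector_derivative D) (at s)"
  shows "((\<lambda>s. matrix_exp ((t - s) *\<^sub>R A) *v \<psi> s) has_vector_derivative
           matrix_exp ((t - s) *\<^sub>R A) *v (D - A *v \<psi> s)) (at s)"
proof -
  have "((\<lambda>s. matrix_exp ((t - s) *\<^sub>R A)) has_vector_derivative
          (-1) *\<^sub>R (matrix_exp ((t - s) *\<^sub>R A) ** A)) (at s)"
  proof -
    have "((\<lambda>s. t - s) has_vector_derivative -1) (at s)"
      by (auto intro!: derivative_eq_intros simp flip: has_real_derivative_iff_has_vector_derivative)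
    from vector_diff_chain_at[OF this matrix_exp_has_vector_derivative[of A]]
    show ?thesis by (simp add: o_def matrix_exp_commute)
  qed
  from bounded_bilinear.has_vector_derivative[OF bounded_bilinear_matrix_vector_mult this assms]
  show ?thesis
    by (simp add: matrix_vector_mul_assoc[symmetric] matrix_vector_mult_diff_distrib
        bounded_bilinear.minus_left[OF bounded_bilinear_matrix_vector_mult])
qed

lemma matrix_exp_add: "matrix_exp ((s + t) *\<^sub>R A) *v x = matrix_exp (s *\<^sub>R A) *v (matrix_exp (t *\<^sub>R A) *v x)"
proof -
  let ?h = "\<lambda>r. matrix_exp ((s + t - r) *\<^sub>R A) *v (matrix_exp (r *\<^sub>R A) *v x)"
  have "((\<lambda>r. matrix_exp (r *\<^sub>R A) *v x) has_vector_derivative A *v (matrix_exp (r *\<^sub>R A) *v x)) (at r)" for r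
    using bounded_linear.has_vector_derivative[OF
        bounded_bilinear.bounded_linear_left[OF bounded_bilinear_matrix_vector_mult]
        matrix_exp_has_vector_derivative]
    by (simp add: matrix_vector_mul_assoc)
  from variation_of_constants_derivative[OF this, of _ A]
  have "(?h has_derivative (\<lambda>_. 0)) (at r within UNIV)" for r
    by (simp add: has_vector_derivative_def)
  then obtain c where "\<And>r. ?h r = c"
    using has_derivative_zero_constant[of UNIV ?h] by auto
  then have "?h 0 = ?h t" by metis
  then show ?thesis by (simp add: matrix_exp_0)
qed

section \<open>Variation of constants for a stable matrix\<close>

text \<open>Reflecting \<open>s\<close> to \<open>- s\<close> carries the known integral over
  \<open>{- t..}\<close> to \<open>{..t}\<close>; nonnegativity supplies the absolute integrability
  that the reflection rule asks for. The value does not depend on \<open>t\<close>, which makes the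
  later bounds uniform in time.\<close>

lemma has_integral_exp_atMost:
  fixes c t :: real
  assumes "c > 0"
  shows "((\<lambda>s. exp (- (c * (t - s)))) has_integral 1 / c) {..t}"
proof -
  have "((\<lambda>s. exp (- c * s)) has_integral exp (- c * (- t)) / c) {- t..}"
    by (rule has_integral_exp_minus_to_infinity[OF assms])
  then have "(\<lambda>s. exp (- c * s)) absolutely_integrable_on {- t..} \<and>
             integral {- t..} (\<lambda>s. exp (- c * s)) = exp (- c * (- t)) / c"
    by (auto intro!: nonnegative_absolutely_integrable_1 simp: has_integral_iff)
  then have "(\<lambda>s. exp (- c * (- s))) absolutely_integrable_on {..t} \<and>
             integral {..t} (\<lambda>s. exp (- c * (- s))) = exp (- c * (- t)) / c"
    by (subst has_absolute_integral_reflect_real[where B = "{- t..}"]) auto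
  then have "((\<lambda>s. exp (c * s)) has_integral exp (c * t) / c) {..t}"
    by (auto simp: has_integral_iff set_lebesgue_integral_eq_integral(1))
  from has_integral_mult_right[OF this, of "exp (- (c * t))"]
  show ?thesis
    by (simp add: exp_add[symmetric] exp_minus algebra_simps)
       (simp add: exp_diff exp_minus field_simps)
qed

locale stable_matrix =
  fixes A :: "real ^ 'm ^ 'm" and N lam :: real
  assumes N_ge_1: "N \<ge> 1" and lam_pos: "lam > 0"
    and exp_bound: "\<And>t. t \<ge> 0 \<Longrightarrow> spectral_norm (matrix_exp (t *\<^sub>R A)) \<le> N * exp (- (lam * t))"
begin

abbreviation propagator :: "real \<Rightarrow> real ^ 'm \<Rightarrow> real ^ 'm" where
  "propagator t x \<equiv> matrix_exp (t *\<^sub>R A) *v x"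

lemma propagator_bound:
  assumes "t \<ge> 0"
  shows "norm (propagator t x) \<le> N * exp (- (lam * t)) * norm x"
proof -
  have "norm (propagator t x) \<le> spectral_norm (matrix_exp (t *\<^sub>R A)) * norm x"
    unfolding spectral_norm_def by (rule onorm) simp
  also have "\<dots> \<le> N * exp (- (lam * t)) * norm x"
    by (intro mult_right_mono exp_bound assms) simp
  finally show ?thesis .
qed

lemma continuous_on_propagator:
  assumes "continuous_on S g" "continuous_on S h"
  shows "continuous_on S (\<lambda>s. propagator (g s) (h s))"
proof -
  have "continuous_on UNIV (\<lambda>t. matrix_exp (t *\<^sub>R A))"
    by (intro continuous_at_imp_continuous_on ballI
        has_vector_derivative_continuous[OF matrix_exp_has_vector_derivative])
  from continuous_on_compose2[OF this assms(1)]
  show ?thesis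
    by (intro bounded_bilinear.continuous_on[OF bounded_bilinear_matrix_vector_mult] assms) auto
qed

text \<open>The integrand is measurable and dominated by a multiple of a decaying exponential. Only
  measurability of \<open>r\<close> is assumed, since the inhomogeneity of the system may jump at
  the points \<open>\<theta> k\<close>.\<close>

lemma propagator_integrable:
  assumes "r \<in> borel_measurable borel" "\<And>s. norm (r s) \<le> R"
  shows "(\<lambda>s. propagator (t - s) (r s)) integrable_on {..t}"
proof (rule measurable_bounded_by_integrable_imp_integrable)
  have "continuous_on UNIV (\<lambda>x. propagator (t - fst x) (snd x))"
    by (intro continuous_on_propagator continuous_intros)
  from borel_measurable_continuous_Pair[OF _ assms(1) this, of "\<lambda>s. s"]
  have "(\<lambda>s. propagator (t - s) (r s)) \<in> borel_measurable borel"
    by simp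
  then have "(\<lambda>s. propagator (t - s) (r s)) \<in> borel_measurable lebesgue"
    by (intro measurable_completion) simp
  then show "(\<lambda>s. propagator (t - s) (r s)) \<in> borel_measurable (lebesgue_on {..t})"
    by (rule measurable_restrict_space1)
  show "(\<lambda>s. N * R * exp (- (lam * (t - s)))) integrable_on {..t}"
    using has_integral_mult_right[OF has_integral_exp_atMost[OF lam_pos]] by blast
  show "norm (propagator (t - s) (r s)) \<le> N * R * exp (- (lam * (t - s)))" if "s \<in> {..t}" for s
  proof -
    have "norm (propagator (t - s) (r s)) \<le> N * exp (- (lam * (t - s))) * norm (r s)"
      using that by (intro propagator_bound) simp
    also have "\<dots> \<le> N * exp (- (lam * (t - s))) * R"
      using N_ge_1 by (intro mult_left_mono assms) simp
    finally show ?thesis by (simp add: mult_ac)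
  qed
qed simp

text \<open>Enlarging \<open>S\<close> to \<open>{..t}\<close> bounds the exponential integral by
  \<open>1 / lam\<close>. A general \<open>S\<close> covers both the half-line of
  \<open>response\<close> and the compact intervals of variation of constants.\<close>

lemma propagator_integral_bound:
  assumes "(\<lambda>s. propagator (t - s) (r s)) integrable_on S" "S \<subseteq> {..t}"
    and "(\<lambda>s. exp (- (lam * (t - s)))) integrable_on S"
    and "\<And>s. s \<in> S \<Longrightarrow> norm (r s) \<le> R" "R \<ge> 0"
  shows "norm (integral S (\<lambda>s. propagator (t - s) (r s))) \<le> N * R / lam"
proof -
  have "norm (integral S (\<lambda>s. propagator (t - s) (r s))) \<le>
        integral S (\<lambda>s. N * R * exp (- (lam * (t - s))))"
  proof (rule integral_norm_bound_integral)
    show "(\<lambda>s. N * R * exp (- (lam * (t - s)))) integrable_on S"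
      by (intro integrable_on_mult_right assms)
    fix s assume s: "s \<in> S"
    have "norm (propagator (t - s) (r s)) \<le> N * exp (- (lam * (t - s))) * norm (r s)"
      using s assms(2) by (intro propagator_bound) auto
    also have "\<dots> \<le> N * exp (- (lam * (t - s))) * R"
      using N_ge_1 by (intro mult_left_mono assms s) simp
    finally show "norm (propagator (t - s) (r s)) \<le> N * R * exp (- (lam * (t - s)))"
      by (simp add: mult_ac)
  qed (rule assms)
  also have "\<dots> = N * R * integral S (\<lambda>s. exp (- (lam * (t - s))))"
    by simp
  also have "\<dots> \<le> N * R * integral {..t} (\<lambda>s. exp (- (lam * (t - s))))"
    using N_ge_1 has_integral_exp_atMost[OF lam_pos, of t] assms
    by (intro mult_left_mono integral_subset_le) auto
  also have "\<dots> = N * R / lam"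
    using has_integral_exp_atMost[OF lam_pos, of t] by (simp add: has_integral_iff)
  finally show ?thesis .
qed

text \<open>The fundamental theorem of calculus for the function differentiated in
  \<open>variation_of_constants_derivative\<close>. The finite set \<open>S\<close> absorbs the
  corners of \<open>\<psi>\<close> at the partition points.\<close>

lemma variation_of_constants:
  assumes "a \<le> t" "finite S" "continuous_on {a..t} \<psi>"
    and "\<And>s. s \<in> {a<..<t} - S \<Longrightarrow> (\<psi> has_vector_derivative A *v \<psi> s + r s) (at s)"
  shows "((\<lambda>s. propagator (t - s) (r s)) has_integral \<psi> t - propagator (t - a) (\<psi> a)) {a..t}"
proof -
  have "((\<lambda>s. propagator (t - s) (r s)) has_integral
          propagator (t - t) (\<psi> t) - propagator (t - a) (\<psi> a)) {a..t}"
  proof (rule fundamental_theorem_of_calculus_interior_strong[OF assms(2,1)])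
    show "continuous_on {a..t} (\<lambda>s. propagator (t - s) (\<psi> s))"
      by (intro continuous_on_propagator continuous_intros assms)
    show "((\<lambda>s. propagator (t - s) (\<psi> s)) has_vector_derivative propagator (t - s) (r s)) (at s)"
      if "s \<in> {a<..<t} - S" for s
      using variation_of_constants_derivative[OF assms(4)[OF that], of t A] by simp
  qed
  then show ?thesis by (simp add: matrix_exp_0)
qed

text \<open>The initial value is damped exponentially, while the inhomogeneity contributes at most
  \<open>N * R / lam\<close> however long the interval is.\<close>

lemma variation_of_constants_bound:
  assumes "a \<le> t" "finite S" "continuous_on {a..t} \<psi>"
    and "\<And>s. s \<in> {a<..<t} - S \<Longrightarrow> (\<psi> has_vector_derivative A *v \<psi> s + r s) (at s)"
    and "\<And>s. s \<in> {a..t} \<Longrightarrow> norm (r s) \<le> R" "R \<ge> 0"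
  shows "norm (\<psi> t) \<le> N * exp (- (lam * (t - a))) * norm (\<psi> a) + N * R / lam"
proof -
  note I = variation_of_constants[OF assms(1-4)]
  have "\<psi> t = propagator (t - a) (\<psi> a) + integral {a..t} (\<lambda>s. propagator (t - s) (r s))"
    using I by (simp add: has_integral_iff)
  also have "norm \<dots> \<le> N * exp (- (lam * (t - a))) * norm (\<psi> a) + N * R / lam"
  proof (intro norm_triangle_le add_mono propagator_bound propagator_integral_bound)
    show "(\<lambda>s. exp (- (lam * (t - s)))) integrable_on {a..t}"
      by (intro integrable_continuous_real continuous_intros)
  qed (use I assms(1,5,6) in \<open>auto simp: has_integral_iff\<close>)
  finally show ?thesis .
qed

section \<open>The bounded response to a bounded inhomogeneity\<close>

text \<open>Variation of constants with the initial time moved to minus infinity. This is the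
  integral operator of the fixed point equation, applied to a given inhomogeneity.\<close>

definition response :: "(real \<Rightarrow> real ^ 'm) \<Rightarrow> real \<Rightarrow> real ^ 'm" where
  "response r t = integral {..t} (\<lambda>s. propagator (t - s) (r s))"

lemma response_bound:
  assumes "r \<in> borel_measurable borel" "\<And>s. norm (r s) \<le> R"
  shows "norm (response r t) \<le> N * R / lam"
  unfolding response_def
proof (rule propagator_integral_bound)
  show "0 \<le> R" using norm_ge_zero assms(2) by (rule order_trans)
qed (use propagator_integrable[OF assms] has_integral_exp_atMost[OF lam_pos] assms in auto)

lemma response_diff:
  assumes "r \<in> borel_measurable borel" "\<And>s. norm (r s) \<le> R"
    and "r' \<in> borel_measurable borel" "\<And>s. norm (r' s) \<le> R'"
  shows "response r t - response r' t = response (\<lambda>s. r s - r' s) t"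
  unfolding response_def
  by (simp add: matrix_vector_mult_diff_distrib
      integral_diff[OF propagator_integrable[OF assms(1,2)] propagator_integrable[OF assms(3,4)]])

text \<open>Factoring out \<open>propagator (t - a)\<close> leaves an integrand that does not depend
  on \<open>t\<close>. Continuity and differentiability in \<open>t\<close> then follow from the
  theorems on indefinite integrals.\<close>

lemma response_step:
  assumes r: "r \<in> borel_measurable borel" "\<And>s. norm (r s) \<le> R" and "a \<le> t"
  shows "(\<lambda>s. propagator (a - s) (r s)) integrable_on {a..t}"
    and "response r t =
         propagator (t - a) (response r a + integral {a..t} (\<lambda>s. propagator (a - s) (r s)))"
proof -
  \<comment> \<open>The second identity runs the propagator backwards over the time
    \<open>a - t\<close>; it transfers integrability from the integrand based at \<open>t\<close> to
    the one based at \<open>a\<close>.\<close>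
  have split: "propagator (t - s) x = propagator (t - a) (propagator (a - s) x)"
    "propagator (a - s) x = propagator (a - t) (propagator (t - s) x)" for s x
    using matrix_exp_add[of "t - a" "a - s" A x] matrix_exp_add[of "a - t" "t - s" A x] by simp_all
  have lin: "bounded_linear (propagator u)" for u
    by simp
  have int_t: "(\<lambda>s. propagator (t - s) (r s)) integrable_on {a..t}"
    using propagator_integrable[OF r, of t]
    by (rule integrable_on_subinterval) auto
  from integrable_linear[OF int_t lin, of "a - t"]
  show int: "(\<lambda>s. propagator (a - s) (r s)) integrable_on {a..t}"
    by (simp add: o_def split(2)[symmetric])
  have "response r t = integral ({..a} \<union> {a..t}) (\<lambda>s. propagator (t - s) (r s))"
  proof -
    have "{..t} = {..a} \<union> {a..t}" using \<open>a \<le> t\<close> by auto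
    then show ?thesis by (simp add: response_def)
  qed
  also have "\<dots> = integral {..a} (\<lambda>s. propagator (t - s) (r s)) +
                  integral {a..t} (\<lambda>s. propagator (t - s) (r s))"
  proof (rule integral_Un)
    show "(\<lambda>s. propagator (t - s) (r s)) integrable_on {..a}"
      using integrable_linear[OF propagator_integrable[OF r, of a] lin, of "t - a"]
      by (simp add: o_def split(1)[symmetric])
    have "{..a} \<inter> {a..t} \<subseteq> {a}" by auto
    then show "negligible ({..a} \<inter> {a..t})"
      by (rule negligible_subset[rotated]) simp
  qed (rule int_t)
  also have "integral {..a} (\<lambda>s. propagator (t - s) (r s)) = propagator (t - a) (response r a)"
    using integral_linear[OF propagator_integrable[OF r, of a] lin, of "t - a"]
    by (simp add: o_def split(1)[symmetric] response_def)
  also have "integral {a..t} (\<lambda>s. propagator (t - s) (r s)) =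
             propagator (t - a) (integral {a..t} (\<lambda>s. propagator (a - s) (r s)))"
    using integral_linear[OF int lin, of "t - a"]
    by (simp add: o_def split(1)[symmetric])
  finally show "response r t =
      propagator (t - a) (response r a + integral {a..t} (\<lambda>s. propagator (a - s) (r s)))"
    by (simp add: matrix_vector_right_distrib)
qed

lemma continuous_on_response:
  assumes r: "r \<in> borel_measurable borel" "\<And>s. norm (r s) \<le> R"
  shows "continuous_on UNIV (response r)"
proof -
  have on_Icc: "continuous_on {a..b} (response r)" for a b
  proof (cases "a \<le> b")
    case True
    have "continuous_on {a..b} (\<lambda>t. propagator (t - a)
            (response r a + integral {a..t} (\<lambda>s. propagator (a - s) (r s))))"
      by (intro continuous_on_propagator continuous_intros indefinite_integral_continuous_1
          response_step(1)[OF r True])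
    then show ?thesis
      by (rule continuous_on_eq) (simp add: response_step(2)[OF r, symmetric])
  qed simp
  show ?thesis
  proof (intro continuous_at_imp_continuous_on ballI)
    fix t :: real
    show "isCont (response r) t"
      using continuous_on_interior[OF on_Icc[of "t - 1" "t + 1"], of t] by simp
  qed
qed

text \<open>On a cell, \<open>r\<close> can jump at the right end \<open>b\<close>; \<open>p\<close>
  is its continuous extension from \<open>{a..<b}\<close>. The derivative within the closed interval
  gives one-sided derivatives at both ends, with \<open>p b\<close> in place of \<open>r b\<close>
  at the right one.\<close>

lemma response_has_vector_derivative:
  assumes r: "r \<in> borel_measurable borel" "\<And>s. norm (r s) \<le> R"
    and p: "continuous_on {a..b} p" "\<And>s. s \<in> {a..<b} \<Longrightarrow> r s = p s"
    and t: "t \<in> {a..b}"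
  shows "(response r has_vector_derivative A *v response r t + p t) (at t within {a..b})"
proof -
  define h where "h = (\<lambda>t. response r a + integral {a..t} (\<lambda>s. propagator (a - s) (p s)))"
  have eq: "response r t = propagator (t - a) (h t)" if "t \<in> {a..b}" for t
  proof -
    \<comment> \<open>The two integrands can differ only at \<open>b\<close>, a null set.\<close>
    have "integral {a..t} (\<lambda>s. propagator (a - s) (r s)) = integral {a..t} (\<lambda>s. propagator (a - s) (p s))"
      using that p(2) by (intro integral_spike[of "{b}"]) auto
    then show ?thesis
      using response_step(2)[OF r, of a t] that by (simp add: h_def)
  qed
  have "continuous_on {a..b} (\<lambda>s. propagator (a - s) (p s))"
    by (intro continuous_on_propagator continuous_intros p)
  then have "(h has_vector_derivative propagator (a - t) (p t)) (at t within {a..b})"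
    unfolding h_def using t
    by (auto intro!: derivative_eq_intros integral_has_vector_derivative)
  moreover have "((\<lambda>t. matrix_exp ((t - a) *\<^sub>R A)) has_vector_derivative
                   A ** matrix_exp ((t - a) *\<^sub>R A)) (at t within {a..b})"
  proof -
    have "((\<lambda>t. t - a) has_vector_derivative 1) (at t)"
      by (auto intro!: derivative_eq_intros simp flip: has_real_derivative_iff_has_vector_derivative)
    from vector_diff_chain_at[OF this matrix_exp_has_vector_derivative[of A]]
    show ?thesis by (simp add: o_def has_vector_derivative_at_within)
  qed
  ultimately have "((\<lambda>t. propagator (t - a) (h t)) has_vector_derivative
      propagator (t - a) (propagator (a - t) (p t)) + (A ** matrix_exp ((t - a) *\<^sub>R A)) *v h t) (at t within {a..b})"
    by (intro bounded_bilinear.has_vector_derivative[OF bounded_bilinear_matrix_vector_mult])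
  also have "propagator (t - a) (propagator (a - t) (p t)) = p t"
    by (simp add: matrix_exp_add[symmetric] matrix_exp_0)
  also have "(A ** matrix_exp ((t - a) *\<^sub>R A)) *v h t = A *v response r t"
    by (simp add: eq[OF t] matrix_vector_mul_assoc)
  finally show ?thesis
    using has_vector_derivative_transform[OF t eq] by (simp add: add.commute)
qed

end

section \<open>Piecewise constant arguments\<close>

locale partition =
  fixes \<theta> \<zeta> :: "int \<Rightarrow> real" and \<omega> :: real
  assumes omega_pos: "\<omega> > 0"
    and theta_zeta: "\<And>k. \<theta> k \<le> \<zeta> k \<and> \<zeta> k \<le> \<theta> (k + 1)"
    and theta_step: "\<And>k. \<theta> (k + 1) - \<theta> k = \<omega>"
begin

lemma theta_eq: "\<theta> k = \<theta> 0 + of_int k * \<omega>"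
proof (induction k rule: int_induct[where k = 0])
  case base
  show ?case by simp
next
  case (step1 i)
  then show ?case using theta_step[of i] by (simp add: algebra_simps)
next
  case (step2 i)
  then show ?case using theta_step[of "i - 1"] by (simp add: algebra_simps)
qed

lemma theta_less_iff: "\<theta> i < \<theta> j \<longleftrightarrow> i < j"
  using omega_pos by (simp add: theta_eq[of i] theta_eq[of j])

lemma theta_le_iff: "\<theta> i \<le> \<theta> j \<longleftrightarrow> i \<le> j"
  using omega_pos by (simp add: theta_eq[of i] theta_eq[of j])

text \<open>An explicit cell index: together with \<open>cell_unique\<close> it makes the
  description in \<open>interval_index\<close> meaningful, and it reduces measurability to that of
  the floor function.\<close>

lemma floor_in_cell:
  "\<theta> \<lfloor>(t - \<theta> 0) / \<omega>\<rfloor> \<le> t \<and> t < \<theta> (\<lfloor>(t - \<theta> 0) / \<omega>\<rfloor> + 1)"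
proof -
  let ?k = "\<lfloor>(t - \<theta> 0) / \<omega>\<rfloor>"
  have "of_int ?k \<le> (t - \<theta> 0) / \<omega>" "(t - \<theta> 0) / \<omega> < of_int ?k + 1"
    by linarith+
  then have "of_int ?k * \<omega> \<le> t - \<theta> 0" "t - \<theta> 0 < (of_int ?k + 1) * \<omega>"
    using omega_pos by (simp_all only: pos_le_divide_eq pos_divide_less_eq)
  then show ?thesis
    using theta_eq[of ?k] theta_eq[of "?k + 1"] by simp
qed

lemma cell_unique:
  assumes "\<theta> i \<le> t" "t < \<theta> (i + 1)" "\<theta> j \<le> t" "t < \<theta> (j + 1)"
  shows "i = j"
proof -
  have "\<theta> i < \<theta> (j + 1)" "\<theta> j < \<theta> (i + 1)" using assms by linarith+
  then show ?thesis by (simp add: theta_less_iff)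
qed

lemma interval_index_eqI:
  assumes "\<theta> k \<le> t" "t < \<theta> (k + 1)"
  shows "interval_index \<theta> t = k"
  unfolding interval_index_def using assms by (blast intro: cell_unique)

lemma interval_index_eq_floor: "interval_index \<theta> t = \<lfloor>(t - \<theta> 0) / \<omega>\<rfloor>"
  using floor_in_cell by (blast intro: interval_index_eqI)

lemma interval_index_bounds:
  "\<theta> (interval_index \<theta> t) \<le> t" "t < \<theta> (interval_index \<theta> t + 1)"
  using floor_in_cell[of t] by (simp_all add: interval_index_eq_floor)

lemma interval_index_ge:
  assumes "\<theta> k \<le> t"
  shows "k \<le> interval_index \<theta> t"
proof -
  have "\<theta> k < \<theta> (interval_index \<theta> t + 1)" using assms interval_index_bounds(2)[of t] by linarith
  then show ?thesis by (simp add: theta_less_iff)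
qed

lemma interval_index_less:
  assumes "t < \<theta> k"
  shows "interval_index \<theta> t < k"
proof -
  have "\<theta> (interval_index \<theta> t) < \<theta> k" using assms interval_index_bounds(1)[of t] by linarith
  then show ?thesis by (simp add: theta_less_iff)
qed

text \<open>The argument stays in the closed cell of \<open>t\<close>, whether it is delayed or
  advanced. Half-lines starting at a partition point are therefore closed under
  \<open>arg_fun\<close>, which is why the cut-off times below are partition points.\<close>

lemma arg_fun_ge: "\<theta> k \<le> t \<Longrightarrow> \<theta> k \<le> arg_fun \<theta> \<zeta> t"
  using interval_index_ge[of k t] theta_zeta[of "interval_index \<theta> t"]
  by (force simp: arg_fun_def theta_le_iff[symmetric])

text \<open>The conclusion is not strict because \<open>\<zeta> k\<close> may be the right end of
  its cell.\<close>

lemma arg_fun_le: "t < \<theta> k \<Longrightarrow> arg_fun \<theta> \<zeta> t \<le> \<theta> k"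
  using interval_index_less[of t k] theta_zeta[of "interval_index \<theta> t"]
    theta_le_iff[of "interval_index \<theta> t + 1" k]
  by (simp add: arg_fun_def)

lemma ex_theta_ge: "\<exists>k\<ge>j. T \<le> \<theta> k"
proof (intro exI conjI)
  let ?k = "max j (interval_index \<theta> T + 1)"
  show "T \<le> \<theta> ?k"
    using interval_index_bounds(2)[of T] theta_le_iff[of "interval_index \<theta> T + 1" ?k] by simp
qed simp

lemma ex_theta_le: "\<exists>k\<le>j. \<theta> k \<le> T"
proof (intro exI conjI)
  let ?k = "min j (interval_index \<theta> T)"
  show "\<theta> ?k \<le> T"
    using interval_index_bounds(1)[of T] theta_le_iff[of ?k "interval_index \<theta> T"] by simp
qed simp

lemma in_open_cell:
  assumes "t \<notin> range \<theta>"
  shows "t \<in> {\<theta> (interval_index \<theta> t)<..<\<theta> (interval_index \<theta> t + 1)}"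
proof -
  have "t \<noteq> \<theta> (interval_index \<theta> t)" using assms by blast
  then show ?thesis using interval_index_bounds[of t] by simp
qed

text \<open>Supplies the finite exceptional set for \<open>variation_of_constants\<close>.\<close>

lemma finite_theta_Icc: "finite (range \<theta> \<inter> {a..b})"
proof -
  have "range \<theta> \<inter> {a..b} \<subseteq> \<theta> ` {interval_index \<theta> a..interval_index \<theta> b}"
  proof
    fix x assume "x \<in> range \<theta> \<inter> {a..b}"
    then obtain k where k: "x = \<theta> k" "a \<le> \<theta> k" "\<theta> k \<le> b" by auto
    have "\<theta> k < \<theta> (interval_index \<theta> b + 1)" using k interval_index_bounds[of b] by linarith
    moreover have "\<theta> (interval_index \<theta> a) \<le> \<theta> k" using k interval_index_bounds[of a] by linarith
    ultimately show "x \<in> \<theta> ` {interval_index \<theta> a..interval_index \<theta> b}"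
      using k by (auto simp: theta_less_iff theta_le_iff)
  qed
  then show ?thesis by (rule finite_subset) simp
qed

lemma measurable_interval_index: "interval_index \<theta> \<in> borel \<rightarrow>\<^sub>M count_space UNIV"
proof -
  have "interval_index \<theta> = (\<lambda>t. \<lfloor>(t - \<theta> 0) / \<omega>\<rfloor>)"
    by (simp add: fun_eq_iff interval_index_eq_floor)
  then show ?thesis by simp
qed

lemma measurable_comp_interval_index:
  fixes h :: "int \<Rightarrow> 'a::topological_space"
  shows "(\<lambda>t. h (interval_index \<theta> t)) \<in> borel_measurable borel"
  by (rule measurable_compose[OF measurable_interval_index]) simp

end

section \<open>From an improving bound to a limit\<close>

text \<open>Iterating \<open>x \<mapsto> q * x + d\<close> from \<open>D\<close> stays below
  \<open>q ^ n * D + d / (1 - q)\<close>. The slack \<open>d\<close> makes the second term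
  \<open>e / 2\<close>, and a large \<open>n\<close> makes the first smaller than
  \<open>e / 2\<close>. The filter is left general: \<open>top\<close> serves uniqueness,
  \<open>at_bot\<close> and \<open>at_top\<close> the two limits.\<close>

lemma eventually_le_of_contraction:
  fixes w :: "'b \<Rightarrow> 'a::real_normed_vector"
  assumes q: "0 \<le> q" "q < 1"
    and bounded: "eventually (\<lambda>t. norm (w t) \<le> D) F" "D \<ge> 0"
    and step: "\<And>c e. c \<ge> 0 \<Longrightarrow> e > 0 \<Longrightarrow> eventually (\<lambda>t. norm (w t) \<le> c) F \<Longrightarrow>
                 eventually (\<lambda>t. norm (w t) \<le> q * c + e) F"
    and "e > 0"
  shows "eventually (\<lambda>t. norm (w t) \<le> e) F"
proof -
  define d where "d = e * (1 - q) / 2"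
  have d: "d > 0" "d / (1 - q) = e / 2" using q \<open>e > 0\<close> by (simp_all add: d_def divide_simps)
  have "eventually (\<lambda>t. norm (w t) \<le> q ^ n * D + d / (1 - q)) F" for n
  proof (induction n)
    case 0
    have "norm (w t) \<le> D \<Longrightarrow> norm (w t) \<le> q ^ 0 * D + d / (1 - q)" for t
      using \<open>e > 0\<close> by (simp add: d(2))
    from eventually_mono[OF bounded(1) this] show ?case .
  next
    case (Suc n)
    have eq: "q * (q ^ n * D + d / (1 - q)) + d = q ^ Suc n * D + d / (1 - q)"
      using q by (simp add: field_simps)
    have "0 \<le> q ^ n * D + d / (1 - q)"
      using q d bounded(2) by simp
    from step[OF this d(1) Suc] show ?case
      unfolding eq .
  qed
  moreover have "(\<lambda>n. q ^ n * D) \<longlonglongrightarrow> 0"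
    using q by (intro tendsto_mult_left_zero LIMSEQ_power_zero) simp
  then have "eventually (\<lambda>n. q ^ n * D < e / 2) sequentially"
    by (rule order_tendstoD(2)) (use \<open>e > 0\<close> in simp)
  then obtain n where n: "q ^ n * D < e / 2"
    by (auto simp: eventually_sequentially)
  have "norm (w t) \<le> q ^ n * D + d / (1 - q) \<Longrightarrow> norm (w t) \<le> e" for t
    using n d(2) by simp
  ultimately show ?thesis by (blast intro: eventually_mono)
qed

lemma norm_tendsto_zero_iff:
  "((\<lambda>t. norm (w t)) \<longlongrightarrow> 0) F \<longleftrightarrow> (\<forall>e>0. eventually (\<lambda>t. norm (w t) \<le> e) F)"
proof
  assume "((\<lambda>t. norm (w t)) \<longlongrightarrow> 0) F"
  then show "\<forall>e>0. eventually (\<lambda>t. norm (w t) \<le> e) F"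
    by (auto dest!: order_tendstoD(2) elim!: eventually_mono)
next
  assume *: "\<forall>e>0. eventually (\<lambda>t. norm (w t) \<le> e) F"
  show "((\<lambda>t. norm (w t)) \<longlongrightarrow> 0) F"
  proof (rule tendstoI)
    fix e :: real assume "e > 0"
    then have "eventually (\<lambda>t. norm (w t) \<le> e / 2) F" by (intro *[rule_format]) simp
    then show "eventually (\<lambda>t. dist (norm (w t)) 0 < e) F"
      using \<open>e > 0\<close> by (auto elim!: eventually_mono)
  qed
qed

section \<open>Bounded solutions and their asymptotics\<close>

text \<open>The assumption \<open>small\<close> says that the contraction factor is below one;
  \<open>contraction_condition\<close> derives it from (A5).\<close>

locale hybrid_system = stable_matrix A N lam + partition \<theta> \<zeta> \<omega>
  for A :: "real ^ 'm ^ 'm" and N lam :: real and \<theta> \<zeta> :: "int \<Rightarrow> real" and \<omega> :: real +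
  fixes f :: "real \<Rightarrow> real ^ 'm \<Rightarrow> real ^ 'm \<Rightarrow> real ^ 'm"
    and M\<^sub>f L\<^sub>1 L\<^sub>2 :: real
  assumes f_continuous: "continuous_on UNIV (\<lambda>(t, x, y). f t x y)"
    and f_bounded: "\<And>t x y. norm (f t x y) \<le> M\<^sub>f"
    and L1: "L\<^sub>1 > 0" "\<And>t x\<^sub>1 x\<^sub>2 y. norm (f t x\<^sub>1 y - f t x\<^sub>2 y) \<le> L\<^sub>1 * norm (x\<^sub>1 - x\<^sub>2)"
    and L2: "L\<^sub>2 > 0" "\<And>t x y\<^sub>1 y\<^sub>2. norm (f t x y\<^sub>1 - f t x y\<^sub>2) \<le> L\<^sub>2 * norm (y\<^sub>1 - y\<^sub>2)"
    and small: "N * (L\<^sub>1 + L\<^sub>2) / lam < 1"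
begin

abbreviation solution :: "(int \<Rightarrow> real ^ 'm) \<Rightarrow> (real \<Rightarrow> real ^ 'm) \<Rightarrow> bool" where
  "solution \<equiv> is_solution A f \<theta> \<zeta>"

definition nonlinearity :: "(int \<Rightarrow> real ^ 'm) \<Rightarrow> (real \<Rightarrow> real ^ 'm) \<Rightarrow> real \<Rightarrow> real ^ 'm" where
  "nonlinearity \<alpha> \<psi> t = f t (\<psi> t) (\<psi> (arg_fun \<theta> \<zeta> t)) + forcing \<theta> t \<alpha>"

lemma system_rhs_eq: "system_rhs A f \<theta> \<zeta> \<alpha> \<psi> t = A *v \<psi> t + nonlinearity \<alpha> \<psi> t"
  by (simp add: system_rhs_def nonlinearity_def add.assoc)

lemma f_Lipschitz: "norm (f t x y - f t x' y') \<le> L\<^sub>1 * norm (x - x') + L\<^sub>2 * norm (y - y')"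
  using norm_triangle_le[OF add_mono[OF L1(2)[of t x y x'] L2(2)[of t x' y y']]] by simp

lemma nonlinearity_diff_bound:
  assumes "norm (\<psi> t - \<eta> t) \<le> c" "norm (\<psi> (arg_fun \<theta> \<zeta> t) - \<eta> (arg_fun \<theta> \<zeta> t)) \<le> c"
    and "norm (forcing \<theta> t \<alpha> - forcing \<theta> t \<beta>) \<le> e"
  shows "norm (nonlinearity \<alpha> \<psi> t - nonlinearity \<beta> \<eta> t) \<le> (L\<^sub>1 + L\<^sub>2) * c + e"
proof -
  let ?g = "arg_fun \<theta> \<zeta> t"
  have "norm (nonlinearity \<alpha> \<psi> t - nonlinearity \<beta> \<eta> t) \<le>
        norm (f t (\<psi> t) (\<psi> ?g) - f t (\<eta> t) (\<eta> ?g)) + norm (forcing \<theta> t \<alpha> - forcing \<theta> t \<beta>)"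
    unfolding nonlinearity_def by (rule norm_diff_triangle_ineq)
  also have "\<dots> \<le> (L\<^sub>1 * norm (\<psi> t - \<eta> t) + L\<^sub>2 * norm (\<psi> ?g - \<eta> ?g)) + e"
    by (intro add_mono f_Lipschitz assms)
  also have "\<dots> \<le> (L\<^sub>1 * c + L\<^sub>2 * c) + e"
    using L1(1) L2(1) assms by (intro add_mono mult_left_mono) auto
  finally show ?thesis by (simp add: algebra_simps)
qed

text \<open>The difference of two solutions solves, away from the partition points, the linear
  equation with the difference of the nonlinearities as inhomogeneity. As \<open>c\<close> bounds
  the difference at \<open>s\<close> and at \<open>arg_fun \<theta> \<zeta> s\<close>, the two
  Lipschitz constants simply add up.\<close>

lemma solution_diff_bound:
  assumes sol: "solution \<alpha> \<psi>" "solution \<beta> \<eta>" and "a \<le> t" "c \<ge> 0" "e \<ge> 0"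
    and w: "\<And>s. s \<in> {a..t} \<Longrightarrow> norm (\<psi> s - \<eta> s) \<le> c"
      "\<And>s. s \<in> {a..t} \<Longrightarrow> norm (\<psi> (arg_fun \<theta> \<zeta> s) - \<eta> (arg_fun \<theta> \<zeta> s)) \<le> c"
      "\<And>s. s \<in> {a..t} \<Longrightarrow> norm (forcing \<theta> s \<alpha> - forcing \<theta> s \<beta>) \<le> e"
  shows "norm (\<psi> t - \<eta> t) \<le> N * exp (- (lam * (t - a))) * norm (\<psi> a - \<eta> a) +
           (N * (L\<^sub>1 + L\<^sub>2) / lam * c + N * e / lam)"
proof -
  let ?r = "\<lambda>s. nonlinearity \<alpha> \<psi> s - nonlinearity \<beta> \<eta> s"
  have "norm (\<psi> t - \<eta> t) \<le> N * exp (- (lam * (t - a))) * norm (\<psi> a - \<eta> a) +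
          N * ((L\<^sub>1 + L\<^sub>2) * c + e) / lam"
  proof (rule variation_of_constants_bound[where \<psi> = "\<lambda>s. \<psi> s - \<eta> s" and r = ?r])
    show "finite (range \<theta> \<inter> {a..t})" by (rule finite_theta_Icc)
    show "continuous_on {a..t} (\<lambda>s. \<psi> s - \<eta> s)"
      using sol unfolding is_solution_def
      by (intro continuous_intros) (auto elim: continuous_on_subset)
    show "((\<lambda>s. \<psi> s - \<eta> s) has_vector_derivative A *v (\<psi> s - \<eta> s) + ?r s) (at s)"
      if "s \<in> {a<..<t} - range \<theta> \<inter> {a..t}" for s
    proof -
      have "s \<notin> range \<theta>" using that by auto
      from in_open_cell[OF this]
      have "(\<psi> has_vector_derivative A *v \<psi> s + nonlinearity \<alpha> \<psi> s) (at s)"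
        "(\<eta> has_vector_derivative A *v \<eta> s + nonlinearity \<beta> \<eta> s) (at s)"
        using sol unfolding is_solution_def system_rhs_eq by blast+
      from has_vector_derivative_diff[OF this] show ?thesis
        by (simp add: matrix_vector_mult_diff_distrib algebra_simps)
    qed
    show "norm (?r s) \<le> (L\<^sub>1 + L\<^sub>2) * c + e" if "s \<in> {a..t}" for s
      using that by (intro nonlinearity_diff_bound w)
    show "0 \<le> (L\<^sub>1 + L\<^sub>2) * c + e"
      using L1(1) L2(1) assms by simp
  qed (rule \<open>a \<le> t\<close>)
  then show ?thesis by (simp add: add_divide_distrib algebra_simps)
qed

lemma contraction_factor_nonneg: "0 \<le> N * (L\<^sub>1 + L\<^sub>2) / lam"
  using N_ge_1 L1(1) L2(1) lam_pos by simp

lemma exp_decay_at_bot: "((\<lambda>a. N * exp (- (lam * (t - a))) * D + B) \<longlongrightarrow> B) at_bot"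
proof -
  have "((\<lambda>a. exp (lam * a)) \<longlongrightarrow> 0) at_bot"
    using lam_pos
    by (intro filterlim_compose[OF exp_at_bot] filterlim_tendsto_pos_mult_at_bot[OF tendsto_const])
       (auto simp: filterlim_ident)
  from tendsto_add[OF tendsto_mult_left[OF this, of "N * exp (- (lam * t)) * D"] tendsto_const[of B]]
  have "((\<lambda>a. N * exp (- (lam * t)) * D * exp (lam * a) + B) \<longlongrightarrow> B) at_bot" by simp
  then show ?thesis
    by (rule Lim_transform_eventually) (simp add: algebra_simps exp_diff exp_minus field_simps)
qed

lemma exp_decay_at_top: "((\<lambda>t. N * exp (- (lam * (t - a))) * D) \<longlongrightarrow> 0) at_top"
proof -
  have "((\<lambda>t. exp (- lam * t)) \<longlongrightarrow> 0) at_top"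
    using lam_pos
    by (intro filterlim_compose[OF exp_at_bot] filterlim_tendsto_neg_mult_at_bot[OF tendsto_const])
       (auto simp: filterlim_ident)
  from tendsto_mult_left[OF this, of "N * exp (lam * a) * D"]
  have "((\<lambda>t. N * exp (lam * a) * D * exp (- lam * t)) \<longlongrightarrow> 0) at_top" by simp
  then show ?thesis
    by (rule Lim_transform_eventually) (simp add: algebra_simps exp_diff exp_minus field_simps)
qed

text \<open>Letting the initial time tend to \<open>-\<infinity>\<close> removes the contribution of the initial value.\<close>

lemma solution_diff_bound_from_minus_infinity:
  assumes sol: "solution \<alpha> \<psi>" "solution \<beta> \<eta>" and "c \<ge> 0" "e \<ge> 0"
    and bounded: "\<And>s. norm (\<psi> s - \<eta> s) \<le> D"
    and w: "\<And>s. s \<le> t \<Longrightarrow> norm (\<psi> s - \<eta> s) \<le> c"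
      "\<And>s. s \<le> t \<Longrightarrow> norm (\<psi> (arg_fun \<theta> \<zeta> s) - \<eta> (arg_fun \<theta> \<zeta> s)) \<le> c"
      "\<And>s. s \<le> t \<Longrightarrow> norm (forcing \<theta> s \<alpha> - forcing \<theta> s \<beta>) \<le> e"
  shows "norm (\<psi> t - \<eta> t) \<le> N * (L\<^sub>1 + L\<^sub>2) / lam * c + N * e / lam"
proof (rule tendsto_lowerbound[OF exp_decay_at_bot])
  have "norm (\<psi> t - \<eta> t) \<le> N * exp (- (lam * (t - a))) * D + (N * (L\<^sub>1 + L\<^sub>2) / lam * c + N * e / lam)"
    if "a \<le> t" for a
  proof -
    have "norm (\<psi> t - \<eta> t) \<le> N * exp (- (lam * (t - a))) * norm (\<psi> a - \<eta> a) +
            (N * (L\<^sub>1 + L\<^sub>2) / lam * c + N * e / lam)"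
      using assms that by (intro solution_diff_bound) auto
    also have "\<dots> \<le> N * exp (- (lam * (t - a))) * D + (N * (L\<^sub>1 + L\<^sub>2) / lam * c + N * e / lam)"
      using N_ge_1 by (intro add_right_mono mult_left_mono bounded) auto
    finally show ?thesis .
  qed
  then show "eventually (\<lambda>a. norm (\<psi> t - \<eta> t) \<le>
      N * exp (- (lam * (t - a))) * D + (N * (L\<^sub>1 + L\<^sub>2) / lam * c + N * e / lam)) at_bot"
    unfolding eventually_at_bot_linorder by blast
qed simp

lemma bounded_diff:
  assumes "bounded (range \<psi>)" "bounded (range \<eta>)"
  obtains D where "D \<ge> 0" "\<And>s. norm (\<psi> s - \<eta> s) \<le> (D::real)"
proof -
  from assms obtain a b where "\<And>s. norm (\<psi> s) \<le> a" "\<And>s. norm (\<eta> s) \<le> b"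
    by (auto simp: bounded_iff)
  then have "norm (\<psi> s - \<eta> s) \<le> a + b" for s
    by (meson add_mono norm_triangle_le_diff order_trans)
  from that[OF order_trans[OF norm_ge_zero this] this] show thesis .
qed

text \<open>Both solutions have the same forcing, so a global bound \<open>c\<close> on their
  difference improves to the contraction factor times \<open>c\<close>.\<close>

lemma bounded_solution_unique:
  assumes sol: "solution \<alpha> \<psi>" "solution \<alpha> \<eta>" and "bounded (range \<psi>)" "bounded (range \<eta>)"
  shows "\<psi> = \<eta>"
proof -
  obtain D where D: "D \<ge> 0" "\<And>s. norm (\<psi> s - \<eta> s) \<le> D"
    using bounded_diff[OF assms(3,4)] by blast
  have le: "norm (\<psi> t - \<eta> t) \<le> e" if "e > 0" for e t
  proof -
    \<comment> \<open>For the filter \<open>top\<close>, eventually means everywhere, so the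
      iteration runs on global bounds.\<close>
    have "eventually (\<lambda>t. norm (\<psi> t - \<eta> t) \<le> e) top"
    proof (rule eventually_le_of_contraction[OF contraction_factor_nonneg small _ D(1) _ that])
      show "eventually (\<lambda>t. norm (\<psi> t - \<eta> t) \<le> D) top"
        using D by simp
      fix c e :: real
      assume "c \<ge> 0" "e > 0" "eventually (\<lambda>t. norm (\<psi> t - \<eta> t) \<le> c) top"
      then have c: "norm (\<psi> t - \<eta> t) \<le> c" for t
        by simp
      have "norm (\<psi> t - \<eta> t) \<le> N * (L\<^sub>1 + L\<^sub>2) / lam * c + N * 0 / lam" for t
        by (rule solution_diff_bound_from_minus_infinity[OF sol \<open>c \<ge> 0\<close> _ D(2) c c]) simp_all
      also have "N * (L\<^sub>1 + L\<^sub>2) / lam * c + N * 0 / lam \<le> N * (L\<^sub>1 + L\<^sub>2) / lam * c + e"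
        using \<open>e > 0\<close> by simp
      finally have "norm (\<psi> t - \<eta> t) \<le> N * (L\<^sub>1 + L\<^sub>2) / lam * c + e" for t .
      then show "eventually (\<lambda>t. norm (\<psi> t - \<eta> t) \<le> N * (L\<^sub>1 + L\<^sub>2) / lam * c + e) top"
        by simp
    qed
    then show ?thesis by simp
  qed
  have "norm (\<psi> t - \<eta> t) \<le> 0" for t
    by (rule dense_ge) (rule le)
  then show ?thesis by (simp add: fun_eq_iff)
qed

section \<open>Asymptotic sequences give asymptotic solutions\<close>

text \<open>Near minus infinity the whole past of \<open>t\<close> lies where both the bound
  \<open>c\<close> and the smallness of the forcing difference are available, so no initial term
  appears.\<close>

lemma solutions_asymptotic_at_bot:
  assumes sol: "solution \<alpha> \<psi>" "solution \<beta> \<eta>" and "bounded (range \<psi>)" "bounded (range \<eta>)"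
    and lim: "((\<lambda>k. norm (\<alpha> k - \<beta> k)) \<longlongrightarrow> 0) at_bot"
  shows "((\<lambda>t. norm (\<psi> t - \<eta> t)) \<longlongrightarrow> 0) at_bot"
  unfolding norm_tendsto_zero_iff
proof (intro allI impI)
  fix e :: real
  assume "e > 0"
  obtain D where D: "D \<ge> 0" "\<And>s. norm (\<psi> s - \<eta> s) \<le> D"
    using bounded_diff[OF assms(3,4)] by blast
  show "eventually (\<lambda>t. norm (\<psi> t - \<eta> t) \<le> e) at_bot"
  proof (rule eventually_le_of_contraction[OF contraction_factor_nonneg small _ D(1) _ \<open>e > 0\<close>])
    show "eventually (\<lambda>t. norm (\<psi> t - \<eta> t) \<le> D) at_bot"
      using D by simp
    fix c e :: real
    assume "c \<ge> 0" "e > 0" and ev: "eventually (\<lambda>t. norm (\<psi> t - \<eta> t) \<le> c) at_bot"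
    \<comment> \<open>Here \<open>e\<close> is the slack of one contraction step and shadows the
      outer \<open>e\<close>; \<open>d\<close> is the forcing tolerance whose contribution to the
      bound is exactly this slack.\<close>
    define d where "d = e * lam / N"
    have d: "d > 0" "N * d / lam = e"
      using \<open>e > 0\<close> lam_pos N_ge_1 by (auto simp: d_def)
    from ev obtain T where T: "\<And>t. t \<le> T \<Longrightarrow> norm (\<psi> t - \<eta> t) \<le> c"
      by (auto simp: eventually_at_bot_linorder)
    from lim d obtain K where K: "\<And>k. k \<le> K \<Longrightarrow> norm (\<alpha> k - \<beta> k) \<le> d"
      unfolding norm_tendsto_zero_iff by (auto simp: eventually_at_bot_linorder)
    obtain j where j: "j \<le> K" "\<theta> j \<le> T" using ex_theta_le by blast
    have "norm (\<psi> t - \<eta> t) \<le> N * (L\<^sub>1 + L\<^sub>2) / lam * c + N * d / lam" if "t < \<theta> j" for t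
    proof (rule solution_diff_bound_from_minus_infinity[OF sol \<open>c \<ge> 0\<close> _ D(2)])
      fix s assume "s \<le> t"
      then have s: "s < \<theta> j" using that by simp
      show "norm (\<psi> s - \<eta> s) \<le> c" using s j by (intro T) simp
      show "norm (\<psi> (arg_fun \<theta> \<zeta> s) - \<eta> (arg_fun \<theta> \<zeta> s)) \<le> c"
        using arg_fun_le[OF s] j by (intro T) simp
      show "norm (forcing \<theta> s \<alpha> - forcing \<theta> s \<beta>) \<le> d"
        unfolding forcing_def using interval_index_less[OF s] j by (intro K) simp
    qed (use d in simp)
    then show "eventually (\<lambda>t. norm (\<psi> t - \<eta> t) \<le> N * (L\<^sub>1 + L\<^sub>2) / lam * c + e) at_bot"
      unfolding eventually_at_bot_dense d(2) by blast
  qed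
qed

text \<open>Here the past is not under control, so the estimate starts at a late partition point
  \<open>\<theta> j\<close>. The initial term this leaves behind decays as \<open>t\<close>
  grows.\<close>

lemma solutions_asymptotic_at_top:
  assumes sol: "solution \<alpha> \<psi>" "solution \<beta> \<eta>" and "bounded (range \<psi>)" "bounded (range \<eta>)"
    and lim: "((\<lambda>k. norm (\<alpha> k - \<beta> k)) \<longlongrightarrow> 0) at_top"
  shows "((\<lambda>t. norm (\<psi> t - \<eta> t)) \<longlongrightarrow> 0) at_top"
  unfolding norm_tendsto_zero_iff
proof (intro allI impI)
  fix e :: real
  assume "e > 0"
  obtain D where D: "D \<ge> 0" "\<And>s. norm (\<psi> s - \<eta> s) \<le> D"
    using bounded_diff[OF assms(3,4)] by blast
  show "eventually (\<lambda>t. norm (\<psi> t - \<eta> t) \<le> e) at_top"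
  proof (rule eventually_le_of_contraction[OF contraction_factor_nonneg small _ D(1) _ \<open>e > 0\<close>])
    show "eventually (\<lambda>t. norm (\<psi> t - \<eta> t) \<le> D) at_top"
      using D by simp
    fix c e :: real
    assume "c \<ge> 0" "e > 0" and ev: "eventually (\<lambda>t. norm (\<psi> t - \<eta> t) \<le> c) at_top"
    \<comment> \<open>Half of the slack is spent on the forcing; the other half is reserved for the
      decaying initial term.\<close>
    define d where "d = e / 2 * lam / N"
    have d: "d > 0" "N * d / lam = e / 2"
      using \<open>e > 0\<close> lam_pos N_ge_1 by (auto simp: d_def)
    from ev obtain T where T: "\<And>t. t \<ge> T \<Longrightarrow> norm (\<psi> t - \<eta> t) \<le> c"
      by (auto simp: eventually_at_top_linorder)
    from lim d obtain K where K: "\<And>k. k \<ge> K \<Longrightarrow> norm (\<alpha> k - \<beta> k) \<le> d"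
      unfolding norm_tendsto_zero_iff by (auto simp: eventually_at_top_linorder)
    obtain j where j: "j \<ge> K" "\<theta> j \<ge> T" using ex_theta_ge by blast
    let ?bound = "\<lambda>t. N * exp (- (lam * (t - \<theta> j))) * norm (\<psi> (\<theta> j) - \<eta> (\<theta> j))"
    have bound: "norm (\<psi> t - \<eta> t) \<le> ?bound t + (N * (L\<^sub>1 + L\<^sub>2) / lam * c + N * d / lam)"
      if "\<theta> j \<le> t" for t
    proof (rule solution_diff_bound[OF sol that \<open>c \<ge> 0\<close>])
      fix s assume "s \<in> {\<theta> j..t}"
      then have s: "\<theta> j \<le> s" by simp
      show "norm (\<psi> s - \<eta> s) \<le> c" using s j by (intro T) simp
      show "norm (\<psi> (arg_fun \<theta> \<zeta> s) - \<eta> (arg_fun \<theta> \<zeta> s)) \<le> c"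
        using arg_fun_ge[OF s] j by (intro T) simp
      show "norm (forcing \<theta> s \<alpha> - forcing \<theta> s \<beta>) \<le> d"
        unfolding forcing_def using interval_index_ge[OF s] j by (intro K) simp
    qed (use d in simp)
    have "(?bound \<longlongrightarrow> 0) at_top"
      by (rule exp_decay_at_top)
    then have "eventually (\<lambda>t. ?bound t < e / 2) at_top"
      by (rule order_tendstoD(2)) (use \<open>e > 0\<close> in simp)
    with eventually_ge_at_top[of "\<theta> j"]
    show "eventually (\<lambda>t. norm (\<psi> t - \<eta> t) \<le> N * (L\<^sub>1 + L\<^sub>2) / lam * c + e) at_top"
    proof eventually_elim
      case (elim t)
      then show ?case using bound[of t] d(2) by simp
    qed
  qed
qed

section \<open>Existence of bounded solutions\<close>

text \<open>A criterion cell by cell, with the delayed argument and the forcing frozen at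
  \<open>\<zeta> k\<close> and \<open>\<alpha> k\<close> up to the right end. At that end only
  existence of the left derivative is taken from it, since the equation there uses the data of the
  next cell.\<close>

lemma solutionI:
  assumes cont: "continuous_on UNIV \<psi>"
    and deriv: "\<And>k t. t \<in> {\<theta> k..\<theta> (k + 1)} \<Longrightarrow>
      (\<psi> has_vector_derivative A *v \<psi> t + (f t (\<psi> t) (\<psi> (\<zeta> k)) + \<alpha> k)) (at t within {\<theta> k..\<theta> (k + 1)})"
  shows "solution \<alpha> \<psi>"
proof -
  have less: "\<theta> k < \<theta> (k + 1)" for k by (simp add: theta_less_iff)
  have rhs: "system_rhs A f \<theta> \<zeta> \<alpha> \<psi> t = A *v \<psi> t + (f t (\<psi> t) (\<psi> (\<zeta> k)) + \<alpha> k)"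
    if "\<theta> k \<le> t" "t < \<theta> (k + 1)" for k t
    using interval_index_eqI[OF that] by (simp add: system_rhs_def arg_fun_def forcing_def)
  have interior: "(\<psi> has_vector_derivative system_rhs A f \<theta> \<zeta> \<alpha> \<psi> t) (at t)"
    if "t \<in> {\<theta> k<..<\<theta> (k + 1)}" for k t
    using deriv[of t k] that rhs[of k t] by (simp add: at_within_Icc_at)
  have right: "(\<psi> has_vector_derivative system_rhs A f \<theta> \<zeta> \<alpha> \<psi> (\<theta> k)) (at_right (\<theta> k))" for k
    using deriv[of "\<theta> k" k] rhs[of k "\<theta> k"] less[of k] by (simp add: at_within_Icc_at_right)
  \<comment> \<open>The left derivative at \<open>\<theta> k\<close> comes from the cell
    \<open>k - 1\<close>, which ends there.\<close>
  have left: "\<exists>D. (\<psi> has_vector_derivative D) (at_left (\<theta> k))" for k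
    using deriv[of "\<theta> k" "k - 1"] less[of "k - 1"] by (auto simp: at_within_Icc_at_left)
  show ?thesis
    unfolding is_solution_def
    using cont interior right left in_open_cell by blast
qed

text \<open>The delayed term and the forcing depend on \<open>t\<close> only through the integer
  \<open>interval_index \<theta> t\<close>, hence are measurable; joint continuity of
  \<open>f\<close> does the rest.\<close>

lemma nonlinearity_measurable:
  assumes "continuous_on UNIV \<psi>"
  shows "nonlinearity \<alpha> \<psi> \<in> borel_measurable borel"
proof -
  have \<psi>: "\<psi> \<in> borel_measurable borel"
    using assms by (rule borel_measurable_continuous_onI)
  have "(\<lambda>t. \<psi> (arg_fun \<theta> \<zeta> t)) \<in> borel_measurable borel"
    unfolding arg_fun_def by (rule measurable_comp_interval_index)
  with \<psi> have "(\<lambda>t. (t, \<psi> t, \<psi> (arg_fun \<theta> \<zeta> t))) \<in> borel_measurable borel"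
    by (simp add: borel_prod[symmetric])
  from measurable_compose[OF this borel_measurable_continuous_onI[OF f_continuous]]
  have "(\<lambda>t. f t (\<psi> t) (\<psi> (arg_fun \<theta> \<zeta> t))) \<in> borel_measurable borel" by simp
  moreover have "(\<lambda>t. forcing \<theta> t \<alpha>) \<in> borel_measurable borel"
    unfolding forcing_def by (rule measurable_comp_interval_index)
  ultimately show ?thesis unfolding nonlinearity_def by simp
qed

lemma nonlinearity_bound:
  assumes "\<And>k. norm (\<alpha> k) \<le> B"
  shows "norm (nonlinearity \<alpha> \<psi> t) \<le> M\<^sub>f + B"
  unfolding nonlinearity_def forcing_def
  by (intro norm_triangle_le add_mono f_bounded assms)

lemma response_fixed_point_solution:
  assumes \<alpha>: "\<And>k. norm (\<alpha> k) \<le> B" and cont: "continuous_on UNIV \<psi>"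
    and fixed: "response (nonlinearity \<alpha> \<psi>) = \<psi>"
  shows "solution \<alpha> \<psi>"
proof (rule solutionI[OF cont])
  fix k t assume t: "t \<in> {\<theta> k..\<theta> (k + 1)}"
  let ?p = "\<lambda>t. f t (\<psi> t) (\<psi> (\<zeta> k)) + \<alpha> k"
  have "continuous_on {\<theta> k..\<theta> (k + 1)} (\<lambda>t. (t, \<psi> t, \<psi> (\<zeta> k)))"
    by (intro continuous_intros continuous_on_subset[OF cont]) simp
  from continuous_on_compose2[OF f_continuous this]
  have "continuous_on {\<theta> k..\<theta> (k + 1)} ?p"
    by (intro continuous_intros) simp
  moreover have "nonlinearity \<alpha> \<psi> s = ?p s" if "s \<in> {\<theta> k..<\<theta> (k + 1)}" for s
    using interval_index_eqI[of k s] that by (simp add: nonlinearity_def arg_fun_def forcing_def)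
  ultimately show "(\<psi> has_vector_derivative A *v \<psi> t + ?p t) (at t within {\<theta> k..\<theta> (k + 1)})"
    using response_has_vector_derivative[OF nonlinearity_measurable[OF cont] nonlinearity_bound[of \<alpha>, OF \<alpha>] _ _ t, of ?p]
    by (simp add: fixed)
qed

text \<open>Banach's fixed point theorem in the complete space of bounded continuous functions. The
  integral operator maps into this space because the nonlinearity is measurable and uniformly
  bounded.\<close>

lemma bounded_solution_exists:
  assumes "bounded (range \<alpha>)"
  shows "\<exists>\<psi>. solution \<alpha> \<psi> \<and> bounded (range \<psi>)"
proof -
  from assms obtain B where \<alpha>: "\<And>k. norm (\<alpha> k) \<le> B"
    by (auto simp: bounded_iff)
  define T where "T \<psi> = Bcontfun (response (nonlinearity \<alpha> (apply_bcontfun \<psi>)))" for \<psi>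
  have meas: "nonlinearity \<alpha> (apply_bcontfun \<psi>) \<in> borel_measurable borel" for \<psi>
    by (intro nonlinearity_measurable continuous_on_apply_bcontfun)
  have "response (nonlinearity \<alpha> (apply_bcontfun \<psi>)) \<in> bcontfun" for \<psi>
    using continuous_on_response[OF meas nonlinearity_bound[OF \<alpha>]]
      response_bound[OF meas nonlinearity_bound[OF \<alpha>]]
    by (rule bcontfun_normI)
  then have T: "apply_bcontfun (T \<psi>) = response (nonlinearity \<alpha> (apply_bcontfun \<psi>))" for \<psi>
    by (simp add: T_def Bcontfun_inverse)
  have "dist (T \<psi>) (T \<eta>) \<le> N * (L\<^sub>1 + L\<^sub>2) / lam * dist \<psi> \<eta>" for \<psi> \<eta>
  proof (rule dist_bound)
    fix t
    let ?r = "\<lambda>s. nonlinearity \<alpha> (apply_bcontfun \<psi>) s - nonlinearity \<alpha> (apply_bcontfun \<eta>) s"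
    \<comment> \<open>The same \<alpha> occurs on both sides, so the forcing cancels and its
      tolerance is \<open>0\<close>.\<close>
    have "norm (?r s) \<le> (L\<^sub>1 + L\<^sub>2) * dist \<psi> \<eta> + 0" for s
      by (intro nonlinearity_diff_bound) (auto simp: dist_norm[symmetric] dist_bounded)
    moreover have "?r \<in> borel_measurable borel"
      by (intro borel_measurable_diff meas)
    ultimately have "norm (response ?r t) \<le> N * ((L\<^sub>1 + L\<^sub>2) * dist \<psi> \<eta> + 0) / lam"
      by (intro response_bound)
    then show "dist (apply_bcontfun (T \<psi>) t) (apply_bcontfun (T \<eta>) t) \<le> N * (L\<^sub>1 + L\<^sub>2) / lam * dist \<psi> \<eta>"
      by (simp add: T dist_norm mult.assoc
          response_diff[OF meas nonlinearity_bound[OF \<alpha>] meas nonlinearity_bound[OF \<alpha>]])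
  qed
  then obtain \<psi> where "T \<psi> = \<psi>"
    using banach_fix_type[OF contraction_factor_nonneg small, of T] by blast
  then have "response (nonlinearity \<alpha> (apply_bcontfun \<psi>)) = apply_bcontfun \<psi>"
    by (simp flip: T)
  then have "solution \<alpha> (apply_bcontfun \<psi>)"
    by (intro response_fixed_point_solution[OF \<alpha>]) simp_all
  moreover have "bounded (range (apply_bcontfun \<psi>))"
    using norm_bounded[of \<psi>] by (auto simp: bounded_iff)
  ultimately show ?thesis by blast
qed

lemma bounded_solution:
  assumes "bounded (range \<alpha>)"
  shows "solution \<alpha> (bounded_solution A f \<theta> \<zeta> \<alpha>)" "bounded (range (bounded_solution A f \<theta> \<zeta> \<alpha>))"
proof -
  have "\<exists>!\<psi>. solution \<alpha> \<psi> \<and> bounded (range \<psi>)"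
    using bounded_solution_exists[OF assms] bounded_solution_unique by blast
  from theI'[OF this]
  show "solution \<alpha> (bounded_solution A f \<theta> \<zeta> \<alpha>)" "bounded (range (bounded_solution A f \<theta> \<zeta> \<alpha>))"
    by (simp_all add: bounded_solution_def)
qed

lemma solution_determines_sequence:
  assumes "solution \<alpha> \<psi>" "solution \<beta> \<psi>"
  shows "\<alpha> = \<beta>"
proof
  fix k
  have "system_rhs A f \<theta> \<zeta> \<alpha> \<psi> (\<theta> k) = system_rhs A f \<theta> \<zeta> \<beta> \<psi> (\<theta> k)"
    using assms unfolding is_solution_def
    by (intro vector_derivative_unique_within[of "\<theta> k" "{\<theta> k<..}" \<psi>]) auto
  moreover have "interval_index \<theta> (\<theta> k) = k"
    by (rule interval_index_eqI) (simp_all add: theta_less_iff)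
  ultimately show "\<alpha> k = \<beta> k"
    by (simp add: system_rhs_def forcing_def)
qed

end

section \<open>The smallness condition\<close>

text \<open>With \<open>u = exp (lam * \<omega> / 2)\<close> the coefficient of
  \<open>L\<^sub>2\<close> in (A5) simplifies to \<open>u * u * (u + 1)\<close>. Since
  \<open>u > 1\<close>, this is at least one, so the bracket dominates
  \<open>L\<^sub>1 + L\<^sub>2\<close>.\<close>

lemma contraction_condition:
  fixes N lam \<omega> L\<^sub>1 L\<^sub>2 :: real
  assumes "N \<ge> 1" "lam > 0" "\<omega> > 0" "L\<^sub>1 > 0" "L\<^sub>2 > 0"
    and A5: "N / lam * (2 * L\<^sub>1 +
               L\<^sub>2 * exp (lam * \<omega> / 2) * (exp (lam * \<omega>) - 1) / (1 - exp (- (lam * \<omega> / 2)))) < 1"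
  shows "N * (L\<^sub>1 + L\<^sub>2) / lam < 1"
proof -
  define u where "u = exp (lam * \<omega> / 2)"
  have u: "u > 1" using assms by (simp add: u_def)
  have "exp (lam * \<omega>) = u * u" "exp (- (lam * \<omega> / 2)) = 1 / u"
    by (simp_all add: u_def exp_minus inverse_eq_divide flip: exp_add)
  moreover have "L\<^sub>2 * u * (u * u - 1) / (1 - 1 / u) = L\<^sub>2 * (u * u * (u + 1))"
    using u by (simp add: divide_simps) (simp add: algebra_simps)
  ultimately have "L\<^sub>2 * exp (lam * \<omega> / 2) * (exp (lam * \<omega>) - 1) / (1 - exp (- (lam * \<omega> / 2))) =
      L\<^sub>2 * (u * u * (u + 1))"
    by (simp only: u_def[symmetric])
  moreover have "1 * 1 \<le> u * u * (u + 1)"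
    using u by (intro mult_mono) (auto intro: mult_ge1_I less_imp_le)
  then have "L\<^sub>2 * 1 \<le> L\<^sub>2 * (u * u * (u + 1))"
    using assms by (intro mult_left_mono) auto
  ultimately have "L\<^sub>1 + L\<^sub>2 \<le> 2 * L\<^sub>1 +
      L\<^sub>2 * exp (lam * \<omega> / 2) * (exp (lam * \<omega>) - 1) / (1 - exp (- (lam * \<omega> / 2)))"
    using \<open>L\<^sub>1 > 0\<close> by linarith
  then have "N / lam * (L\<^sub>1 + L\<^sub>2) \<le> N / lam * (2 * L\<^sub>1 +
      L\<^sub>2 * exp (lam * \<omega> / 2) * (exp (lam * \<omega>) - 1) / (1 - exp (- (lam * \<omega> / 2))))"
    using assms by (intro mult_left_mono) auto
  also note A5
  finally show ?thesis by simp
qed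

section \<open>Transfer from sequences to bounded solutions\<close>

theorem theorem3p1:
  fixes A :: "real ^ 'm ^ 'm"
    and f :: "real \<Rightarrow> real ^ 'm \<Rightarrow> real ^ 'm \<Rightarrow> real ^ 'm"
    and \<theta> \<zeta> :: "int \<Rightarrow> real"
    and F :: "real ^ 'm \<Rightarrow> real ^ 'm"
    and \<Gamma> :: "(real ^ 'm) set"
    and \<Lambda> :: "(int \<Rightarrow> real ^ 'm) set"
    and \<phi> :: "(int \<Rightarrow> real ^ 'm) \<Rightarrow> real \<Rightarrow> real ^ 'm"
    and \<Omega> :: "(real \<Rightarrow> real ^ 'm) set"
    and \<omega> N lam M\<^sub>f L\<^sub>1 L\<^sub>2 :: real
  assumes eigenvalues: "\<And>c. complex_eigenvalue A c \<Longrightarrow> Re c < 0"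
    and f_continuous: "continuous_on UNIV (\<lambda>(t, x, y). f t x y)"
    and omega_pos: "\<omega> > 0"
    and theta_zeta: "\<And>k. \<theta> k \<le> \<zeta> k \<and> \<zeta> k \<le> \<theta> (k + 1)"
    and theta_step: "\<And>k. \<theta> (k + 1) - \<theta> k = \<omega>"
    and Gamma_bounded: "bounded \<Gamma>"
    and F_maps: "F \<in> \<Gamma> \<rightarrow> \<Gamma>"
    and F_continuous: "continuous_on \<Gamma> F"
    and Lambda_eq: "\<Lambda> = orbits F \<Gamma>"
    and N_ge_1: "N \<ge> 1"
    and lam_pos: "lam > 0"
    and exp_bound: "\<And>t. t \<ge> 0 \<Longrightarrow> spectral_norm (matrix_exp (t *\<^sub>R A)) \<le> N * exp (- (lam * t))"
    and A1: "M\<^sub>f > 0" "\<And>t x y. norm (f t x y) \<le> M\<^sub>f"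
    and A2: "L\<^sub>1 > 0" "\<And>t x\<^sub>1 x\<^sub>2 y. norm (f t x\<^sub>1 y - f t x\<^sub>2 y) \<le> L\<^sub>1 * norm (x\<^sub>1 - x\<^sub>2)"
    and A3: "L\<^sub>2 > 0" "\<And>t x y\<^sub>1 y\<^sub>2. norm (f t x y\<^sub>1 - f t x y\<^sub>2) \<le> L\<^sub>2 * norm (y\<^sub>1 - y\<^sub>2)"
    and A5: "N / lam * (2 * L\<^sub>1 +
               L\<^sub>2 * exp (lam * \<omega> / 2) * (exp (lam * \<omega>) - 1) / (1 - exp (- (lam * \<omega> / 2)))) < 1"
    and phi_eq: "\<phi> = bounded_solution A f \<theta> \<zeta>"
    and Omega_eq: "\<Omega> = \<phi> ` \<Lambda>"
  shows "(\<forall>\<alpha>\<in>\<Lambda>. \<forall>\<beta>\<in>\<Lambda>. homoclinic \<Lambda> \<beta> \<alpha> \<longrightarrow> homoclinic_fun \<Lambda> \<phi> \<beta> \<alpha>) \<and>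
         (\<forall>\<alpha>1\<in>\<Lambda>. \<forall>\<alpha>2\<in>\<Lambda>. \<forall>\<beta>\<in>\<Lambda>.
            heteroclinic \<Lambda> \<beta> \<alpha>1 \<alpha>2 \<longrightarrow> heteroclinic_fun \<Lambda> \<phi> \<beta> \<alpha>1 \<alpha>2) \<and>
         (hyperbolic \<Lambda> \<longrightarrow> hyperbolic \<Omega>)"
proof -
  interpret hybrid_system A N lam \<theta> \<zeta> \<omega> f M\<^sub>f L\<^sub>1 L\<^sub>2
  proof (intro hybrid_system.intro stable_matrix.intro partition.intro hybrid_system_axioms.intro)
    show "N * (L\<^sub>1 + L\<^sub>2) / lam < 1"
      by (rule contraction_condition[OF N_ge_1 lam_pos omega_pos A2(1) A3(1) A5])
  qed (rule N_ge_1 lam_pos exp_bound omega_pos theta_zeta theta_step f_continuous A1 A2 A3; assumption)+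
  \<comment> \<open>Orbits stay in the bounded set \<Gamma>, so every \<alpha> in \<Lambda> has a
    bounded solution, and \<open>\<phi> \<alpha>\<close> is that solution.\<close>
  have "bounded (range \<alpha>)" if "\<alpha> \<in> \<Lambda>" for \<alpha>
    using that unfolding Lambda_eq orbits_def by (intro bounded_subset[OF Gamma_bounded]) blast
  then have sol: "solution \<alpha> (\<phi> \<alpha>)" "bounded (range (\<phi> \<alpha>))" if "\<alpha> \<in> \<Lambda>" for \<alpha>
    using that bounded_solution by (simp_all add: phi_eq)
  have stable: "\<phi> \<beta> \<in> stable_set (\<phi> ` \<Lambda>) (\<phi> \<alpha>)" if "\<alpha> \<in> \<Lambda>" "\<beta> \<in> stable_set \<Lambda> \<alpha>" for \<alpha> \<beta>
  proof -
    from that have \<beta>: "\<beta> \<in> \<Lambda>" "((\<lambda>k. norm (\<alpha> k - \<beta> k)) \<longlongrightarrow> 0) at_top"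
      by (simp_all add: stable_set_def)
    from solutions_asymptotic_at_top[OF sol(1)[OF that(1)] sol(1)[OF \<beta>(1)] sol(2)[OF that(1)] sol(2)[OF \<beta>(1)] \<beta>(2)] \<beta>(1)
    show ?thesis by (simp add: stable_set_def)
  qed
  have unstable: "\<phi> \<beta> \<in> unstable_set (\<phi> ` \<Lambda>) (\<phi> \<alpha>)" if "\<alpha> \<in> \<Lambda>" "\<beta> \<in> unstable_set \<Lambda> \<alpha>" for \<alpha> \<beta>
  proof -
    from that have \<beta>: "\<beta> \<in> \<Lambda>" "((\<lambda>k. norm (\<alpha> k - \<beta> k)) \<longlongrightarrow> 0) at_bot"
      by (simp_all add: unstable_set_def)
    from solutions_asymptotic_at_bot[OF sol(1)[OF that(1)] sol(1)[OF \<beta>(1)] sol(2)[OF that(1)] sol(2)[OF \<beta>(1)] \<beta>(2)] \<beta>(1)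
    show ?thesis by (simp add: unstable_set_def)
  qed
  \<comment> \<open>Hyperbolicity of \<Omega> asks for distinct functions, not merely for distinct
    indices, so \<phi> has to be injective on \<Lambda>.\<close>
  have inj: "\<phi> \<alpha> \<noteq> \<phi> \<beta>" if "\<alpha> \<in> \<Lambda>" "\<beta> \<in> \<Lambda>" "\<alpha> \<noteq> \<beta>" for \<alpha> \<beta>
    using solution_determines_sequence[of \<alpha> "\<phi> \<alpha>" \<beta>] sol(1)[OF that(1)] sol(1)[OF that(2)] that(3)
    by auto
  have "hyperbolic \<Omega>" if "hyperbolic \<Lambda>"
    unfolding hyperbolic_def Omega_eq
  proof (intro ballI conjI)
    fix x assume "x \<in> \<phi> ` \<Lambda>"
    then obtain \<alpha> where \<alpha>: "x = \<phi> \<alpha>" "\<alpha> \<in> \<Lambda>" by blast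
    with that obtain \<beta> where \<beta>: "\<beta> \<in> stable_set \<Lambda> \<alpha>" "\<beta> \<noteq> \<alpha>"
      unfolding hyperbolic_def by blast
    from that \<alpha> obtain \<beta>' where \<beta>': "\<beta>' \<in> unstable_set \<Lambda> \<alpha>" "\<beta>' \<noteq> \<alpha>"
      unfolding hyperbolic_def by blast
    from \<beta> \<beta>' have "\<beta> \<in> \<Lambda>" "\<beta>' \<in> \<Lambda>" by (auto simp: stable_set_def unstable_set_def)
    then have "\<phi> \<beta> \<noteq> x" "\<phi> \<beta>' \<noteq> x"
      using inj \<alpha> \<beta>(2) \<beta>'(2) by simp_all
    moreover have "\<phi> \<beta> \<in> stable_set (\<phi> ` \<Lambda>) x" "\<phi> \<beta>' \<in> unstable_set (\<phi> ` \<Lambda>) x"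
      using stable[OF \<alpha>(2) \<beta>(1)] unstable[OF \<alpha>(2) \<beta>'(1)] \<alpha>(1) by simp_all
    ultimately show "\<exists>y\<in>stable_set (\<phi> ` \<Lambda>) x. y \<noteq> x" "\<exists>y\<in>unstable_set (\<phi> ` \<Lambda>) x. y \<noteq> x"
      by blast+
  qed
  \<comment> \<open>In (i) and (ii) the distinctness conditions concern the indexing sequences and
    carry over unchanged; only the stable and unstable sets have to be transferred.\<close>
  then show ?thesis
    unfolding homoclinic_def homoclinic_fun_def heteroclinic_def heteroclinic_fun_def
    using stable unstable by blast
qed

end
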